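(* Let $i, j, k, l$ be nonnegative integers, and let $n = 2^i \cdot 3^j \cdot 5^k \cdot 7^l$. Then there exists a snark $G$ (in particular, $G$ is at least cyclically 4-edge-connected) with an edge $e$ such that $\psi(G,e) = n$.
   Context: All graphs are undirected. A graph is simple if it is connected, has finitely many vertices, and has no loops or multiple edges; it is cubic if each vertex is attached to exactly 3 edges. A 3-edge-colouring assigns one of three colours to each edge so that no two adjacent edges receive the same colour. A 3-edge-decomposition is a partition of the edges into three (unordered) classes such that no two adjacent edges are in the same class; so each 3-edge-decomposition of a cubic graph corresponds to exactly $3! = 6$ 3-edge-colourings. For a positive integer $m$, two disjoint (no common vertices) connected subgraphs $A,B$ of a simple graph $G$ are $m$-edge-connected to each other in $G$ if there exist $m$ mutually edge-disjoint paths in $G$, each having one endpoint in $A$ and the other in $B$ (equivalently, there is no set $S$ of at most $m-1$ edges of $G$ such that $A$ and $B$ lie in different components of $G-S$). A simple graph $G$ is cyclically $m$-edge-connected if every two vertex-disjoint cycles of $G$ are $m$-edge-connected to each other in $G$. A snark is a simple cubic graph that is not 3-edge-colourable, has girth at least 5, and is (at least) cyclically 4-edge-connected. Edge subtraction: given an edge $e=(u,v)$ of a cubic graph $G$, remove $e$; this leaves divalent vertices $u$ and $v$, with edges $(u,u_1),(u,u_2),(v,v_1),(v,v_2)$. Delete $u$ and $v$ and these edges, and form new edges $(u_1,u_2)$ and $(v_1,v_2)$. The resulting cubic graph is $G_e$. The number $\psi(G,e)$: for $G$ a simple, non-3-edge-colourable cubic graph and $e$ an edge of $G$, it is known that the number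 of 3-edge-decompositions of $G_e$ equals $3J$ for some nonnegative integer $J$ (possibly $0$); define $\psi(G,e) := J$. Equivalently, the number of 3-edge-colourings of $G_e$ (with a fixed set of three colours) is $18\,\psi(G,e)$. *)

theory Defs
  imports Main "HOL-Library.Extended_Nat" "HOL-Library.Disjoint_Sets" "HOL-Library.FuncSet"
begin

text \<open>
  Undirected multigraphs. They are needed because subtracting an edge from a simple graph can
  create parallel edges. Each edge has a set of one (for a loop) or two endpoints.
\<close>

record ('v, 'e) multigraph =
  verts :: "'v set"
  edges :: "'e set"
  ends :: "'e \<Rightarrow> 'v set"

definition wf_multigraph :: "('v, 'e) multigraph \<Rightarrow> bool" where
  "wf_multigraph G \<longleftrightarrow>
     (\<forall>e \<in> edges G. ends G e \<subseteq> verts G \<and> card (ends G e) \<in> {1, 2})"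

definition walk :: "('v, 'e) multigraph \<Rightarrow> 'v list \<Rightarrow> 'e list \<Rightarrow> bool" where
  "walk G vs es \<longleftrightarrow>
     set vs \<subseteq> verts G \<and> set es \<subseteq> edges G \<and> length vs = Suc (length es) \<and>
     (\<forall>i < length es. ends G (es ! i) = {vs ! i, vs ! Suc i})"

definition path :: "('v, 'e) multigraph \<Rightarrow> 'v list \<Rightarrow> 'e list \<Rightarrow> bool" where
  "path G vs es \<longleftrightarrow> walk G vs es \<and> distinct vs"

text \<open>The first vertex of a cycle is repeated at the end of the vertex list. Distinctness of
  the edges excludes traversing a single edge back and forth.\<close>

definition cycle :: "('v, 'e) multigraph \<Rightarrow> 'v list \<Rightarrow> 'e list \<Rightarrow> bool" where
  "cycle G vs es \<longleftrightarrow>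
     walk G vs es \<and> es \<noteq> [] \<and> hd vs = last vs \<and> distinct (tl vs) \<and> distinct es"

definition connected_graph :: "('v, 'e) multigraph \<Rightarrow> bool" where
  "connected_graph G \<longleftrightarrow> verts G \<noteq> {} \<and>
     (\<forall>u \<in> verts G. \<forall>v \<in> verts G. \<exists>vs es. path G vs es \<and> hd vs = u \<and> last vs = v)"

definition simple_graph :: "('v, 'e) multigraph \<Rightarrow> bool" where
  "simple_graph G \<longleftrightarrow>
     wf_multigraph G \<and> connected_graph G \<and> finite (verts G) \<and>
     (\<forall>e \<in> edges G. card (ends G e) = 2) \<and> inj_on (ends G) (edges G)"

definition cubic :: "('v, 'e) multigraph \<Rightarrow> bool" where
  "cubic G \<longleftrightarrow> (\<forall>v \<in> verts G. card {e \<in> edges G. v \<in> ends G e} = 3)"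

definition girth :: "('v, 'e) multigraph \<Rightarrow> enat" where
  "girth G = Inf {enat (length es) | vs es. cycle G vs es}"

definition adjacent_edges :: "('v, 'e) multigraph \<Rightarrow> 'e \<Rightarrow> 'e \<Rightarrow> bool" where
  "adjacent_edges G e f \<longleftrightarrow> e \<noteq> f \<and> ends G e \<inter> ends G f \<noteq> {}"

definition three_edge_colouring :: "('v, 'e) multigraph \<Rightarrow> ('e \<Rightarrow> nat) \<Rightarrow> bool" where
  "three_edge_colouring G c \<longleftrightarrow>
     c \<in> edges G \<rightarrow> {..<3} \<and>
     (\<forall>e \<in> edges G. \<forall>f \<in> edges G. adjacent_edges G e f \<longrightarrow> c e \<noteq> c f)"

definition three_edge_colourable :: "('v, 'e) multigraph \<Rightarrow> bool" where
  "three_edge_colourable G \<longleftrightarrow> (\<exists>c. three_edge_colouring G c)"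

text \<open>The three classes are nonempty; in a nonempty cubic loopless graph this is automatic,
  since every class meets every vertex.\<close>

definition three_edge_decomposition :: "('v, 'e) multigraph \<Rightarrow> 'e set set \<Rightarrow> bool" where
  "three_edge_decomposition G P \<longleftrightarrow>
     partition_on (edges G) P \<and> card P = 3 \<and>
     (\<forall>C \<in> P. \<forall>e \<in> C. \<forall>f \<in> C. \<not> adjacent_edges G e f)"

text \<open>\<open>A\<close> and \<open>B\<close> are the vertex sets of two disjoint connected subgraphs; the notion does not
  depend on the edges of these subgraphs.\<close>

definition edge_connected_to ::
  "('v, 'e) multigraph \<Rightarrow> nat \<Rightarrow> 'v set \<Rightarrow> 'v set \<Rightarrow> bool" where
  "edge_connected_to G m A B \<longleftrightarrow>
     (\<exists>(vs :: nat \<Rightarrow> 'v list) (es :: nat \<Rightarrow> 'e list).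
        (\<forall>i < m. path G (vs i) (es i) \<and> hd (vs i) \<in> A \<and> last (vs i) \<in> B) \<and>
        (\<forall>i < m. \<forall>j < m. i \<noteq> j \<longrightarrow> set (es i) \<inter> set (es j) = {}))"

definition cyclically_edge_connected :: "('v, 'e) multigraph \<Rightarrow> nat \<Rightarrow> bool" where
  "cyclically_edge_connected G m \<longleftrightarrow>
     (\<forall>vs es vs' es'. cycle G vs es \<and> cycle G vs' es' \<and> set vs \<inter> set vs' = {}
        \<longrightarrow> edge_connected_to G m (set vs) (set vs'))"

definition snark :: "('v, 'e) multigraph \<Rightarrow> bool" where
  "snark G \<longleftrightarrow>
     simple_graph G \<and> cubic G \<and> \<not> three_edge_colourable G \<and> girth G \<ge> 5 \<and>
     cyclically_edge_connected G 4"

text \<open>The edge subtraction \<open>G\<^sub>e\<close>, for a simple cubic graph \<open>G\<close>. If \<open>e\<close> has the ends \<open>u\<close> and \<open>v\<close>,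
  then the two new edges are named \<open>Inr u\<close> and \<open>Inr v\<close>. The ends of \<open>Inr u\<close> are the two
  neighbours of \<open>u\<close> along the edges other than \<open>e\<close>, and likewise for \<open>Inr v\<close>. The surviving old
  edges \<open>f\<close> become \<open>Inl f\<close>.\<close>

definition edge_subtraction :: "('v, 'e) multigraph \<Rightarrow> 'e \<Rightarrow> ('v, 'e + 'v) multigraph" where
  "edge_subtraction G e =
     \<lparr> verts = verts G - ends G e,
       edges = Inl ` {f \<in> edges G. ends G f \<inter> ends G e = {}} \<union> Inr ` ends G e,
       ends = case_sum (ends G) (\<lambda>w. {x. \<exists>f \<in> edges G - {e}. ends G f = {w, x}}) \<rparr>"

text \<open>Meaningful for an edge \<open>e\<close> of a simple cubic graph \<open>G\<close> that is not 3-edge-colourable: then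
  the number of decompositions of \<open>G\<^sub>e\<close> is known to be a multiple of 3.\<close>

definition psi :: "('v, 'e) multigraph \<Rightarrow> 'e \<Rightarrow> nat" where
  "psi G e = (THE J. card {P. three_edge_decomposition (edge_subtraction G e) P} = 3 * J)"

end

theory Submission
  imports Defs "HOL-Library.Multiset"
begin

text \<open>
  A pole is a cubic graph with dangling edges (strands). For a snark with a pentagon removed, Kempe
  switching shows that the colourings of the remaining 5-pole are, up to a factor, distributed as
  in the Petersen graph: the two colours occurring once on the strands sit at cyclically
  nonadjacent positions, all such patterns having the same number of colourings. That factor is
  the value of \<open>\<psi>\<close> on the edges of the pentagon, so replacing a pentagon of a snark with factor
  \<open>p\<close> by a pole with factor \<open>n\<close> yields a pole with factor \<open>n * p\<close>. Snarks on 20 or 22 vertices with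
  two disjoint pentagons give the factors 2, 3 and 5, and one on 24 vertices gives 7; without their
  two pentagons they become the four blocks, which are stacked and finally closed by a
  pentagon containing the edge \<open>e\<close>.

  All requirements are followed while the graph is built vertex by vertex: the number of colourings
  for each pattern of colours on the strands, lower bounds for edge cuts in terms of the side
  on which each strand lies, and lower bounds for the distances between strands, which exclude
  cycles of length at most 4. The data at the ends of a block do not depend on the number of
  blocks, so each block is a finite computation. Menger's theorem turns the cut bound into cyclic
  4-edge-connectivity.
\<close>

section \<open>Poles\<close>

text \<open>By parity, each colour occurs an odd number of times on the strands of a 3-edge-coloured
  5-pole, so one colour occurs three times and the other two once. A pentagon whose strands are
  listed in the order of its vertices admits exactly the patterns whose two single colours are
  neighbours, each in one way. The strands of the initial pentagon are listed in pentagram order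
  instead (neighbouring positions belong to nonadjacent vertices), so that it admits the
  nonneighbouring patterns. A closing pentagon that meets the strands in list order then admits none
  of them, and no colouring is left; for the initial pentagon alone this closure is the Petersen
  graph. Subtracting an edge of the closing pentagon relaxes the condition: once the colours at one
  vertex are fixed, four patterns are possible and three of them are nonneighbouring, which is the
  factor 3 in the definition of \<open>psi\<close>. The numbers of colourings are kept as a symbolic
  factor times a fixed table; otherwise the state to be computed with would grow with the number of
  blocks.\<close>

definition pull :: "nat \<Rightarrow> 'a list \<Rightarrow> 'a list" where
  "pull k xs = xs ! k # take k xs @ drop (Suc k) xs"

lemma length_pull: "k < length xs \<Longrightarrow> length (pull k xs) = length xs"
  by (simp add: pull_def)

lemma mset_pull: "k < length xs \<Longrightarrow> mset (pull k xs) = mset xs"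
proof -
  assume "k < length xs"
  then have "mset xs = mset (take k xs @ xs ! k # drop (Suc k) xs)" by (metis id_take_nth_drop)
  then show ?thesis by (simp add: pull_def)
qed

lemma set_pull: "k < length xs \<Longrightarrow> set (pull k xs) = set xs"
  by (metis mset_pull mset_eq_setD)

lemma distinct_pull: "k < length xs \<Longrightarrow> distinct (pull k xs) = distinct xs"
  by (metis mset_pull mset_eq_imp_distinct_iff)

lemma map_pull: "k < length xs \<Longrightarrow> map f (pull k xs) = pull k (map f xs)"
  by (simp add: pull_def take_map drop_map)

lemma pull_eq_Cons_iff:
  assumes "k < length xs"
  shows "pull k xs = y # ys \<longleftrightarrow> length ys = length xs - 1 \<and> xs = take k ys @ y # drop k ys"
proof
  assume "pull k xs = y # ys"
  hence y: "y = xs ! k" and ys: "ys = take k xs @ drop (Suc k) xs" by (auto simp: pull_def)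
  have 1: "take k ys = take k xs" "drop k ys = drop (Suc k) xs" using assms by (auto simp: ys)
  have 2: "length ys = length xs - 1" using assms by (simp add: ys)
  show "length ys = length xs - 1 \<and> xs = take k ys @ y # drop k ys"
    unfolding 1 y by (intro conjI 2 id_take_nth_drop[OF assms])
next
  assume *: "length ys = length xs - 1 \<and> xs = take k ys @ y # drop k ys"
  define us where "us = take k ys"
  have k: "length us = k" using assms conjunct1[OF *] by (simp add: us_def)
  have xs: "xs = us @ y # drop k ys" unfolding us_def by (rule conjunct2[OF *])
  have "pull k xs = y # us @ drop k ys"
    unfolding pull_def xs using k by (simp add: nth_append)
  then show "pull k xs = y # ys" by (simp add: us_def)
qed

lemma nth_pull:
  assumes "k < length xs" "i < length xs"
  shows "pull k xs ! i = xs ! (if i = 0 then k else if i \<le> k then i - 1 else i)"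
proof (cases i)
  case (Suc m)
  then show ?thesis using assms by (auto simp: pull_def nth_append min_def)
qed (simp add: pull_def)

text \<open>\<open>inc\<close> lists the three edges at a vertex, \<open>str\<close> the dangling edges.\<close>

record pole =
  nv :: nat
  ne :: nat
  inc :: "nat \<Rightarrow> nat list"
  str :: "nat list"

text \<open>A vertex is only ever attached at the front of the strand list, and \<open>Pull\<close>
  brings the required strands there. In tables organised by strands, attaching a vertex then changes
  the leading levels only.\<close>

datatype step = Pull nat | Vertex nat

fun extend :: "step \<Rightarrow> pole \<Rightarrow> pole" where
  "extend (Pull k) p = p\<lparr>str := pull k (str p)\<rparr>"
| "extend (Vertex t) p =
     \<lparr>nv = Suc (nv p), ne = ne p + (3 - t),
      inc = (inc p)(nv p := take t (str p) @ [ne p..<ne p + (3 - t)]),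
      str = [ne p..<ne p + (3 - t)] @ drop t (str p)\<rparr>"

fun applicable :: "step \<Rightarrow> nat \<Rightarrow> bool" where
  "applicable (Pull k) n \<longleftrightarrow> k < n"
| "applicable (Vertex t) n \<longleftrightarrow> t \<le> 3 \<and> t \<le> n"

definition owners :: "pole \<Rightarrow> nat \<Rightarrow> nat set" where
  "owners p e = {v. v < nv p \<and> e \<in> set (inc p v)}"

definition wf_pole :: "pole \<Rightarrow> bool" where
  "wf_pole p \<longleftrightarrow>
     (\<forall>v < nv p. length (inc p v) = 3 \<and> distinct (inc p v) \<and> set (inc p v) \<subseteq> {..<ne p}) \<and>
     distinct (str p) \<and> set (str p) \<subseteq> {..<ne p} \<and>
     (\<forall>e < ne p. card (owners p e) = (if e \<in> set (str p) then 1 else 2))"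

lemma owners_Vertex:
  "wf_pole p \<Longrightarrow> owners (extend (Vertex t) p) e =
     owners p e \<union> (if e \<in> set (take t (str p)) \<or> ne p \<le> e \<and> e < ne p + (3 - t) then {nv p} else {})"
  by (auto simp: owners_def less_Suc_eq)

lemma owners_Pull [simp]: "owners (extend (Pull k) p) e = owners p e"
  by (simp add: owners_def)

lemma finite_owners [simp]: "finite (owners p e)"
  by (simp add: owners_def)

lemma owners_new: "wf_pole p \<Longrightarrow> ne p \<le> e \<Longrightarrow> owners p e = {}"
  by (auto simp: owners_def wf_pole_def) (meson lessThan_iff not_less subsetD)

lemma nv_notin_owners [simp]: "nv p \<notin> owners p e"
  by (simp add: owners_def)

lemma wf_pole_extend:
  assumes wf: "wf_pole p" and app: "applicable s (length (str p))"
  shows "wf_pole (extend s p)"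
proof (cases s)
  case (Pull k)
  then show ?thesis using assms
    by (simp add: wf_pole_def set_pull distinct_pull owners_def)
next
  case (Vertex t)
  have t: "t \<le> 3" "t \<le> length (str p)" using app Vertex by auto
  have d: "distinct (str p)" and sub: "set (str p) \<subseteq> {..<ne p}" using wf by (auto simp: wf_pole_def)
  have disj: "set (take t (str p)) \<inter> set (drop t (str p)) = {}"
    using d by (metis append_take_drop_id distinct_append)
  have un: "set (str p) = set (take t (str p)) \<union> set (drop t (str p))"
    by (metis append_take_drop_id set_append)
  let ?q = "extend (Vertex t) p"
  have ow: "card (owners ?q e) = (if e \<in> set (str ?q) then 1 else 2)" if e: "e < ne ?q" for e
  proof (cases "e < ne p")
    case True
    hence c: "card (owners p e) = (if e \<in> set (str p) then 1 else 2)"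
      using wf by (auto simp: wf_pole_def)
    show ?thesis
    proof (cases "e \<in> set (take t (str p))")
      case True
      then show ?thesis using c \<open>e < ne p\<close> disj un
        by (subst owners_Vertex[OF wf]) auto
    next
      case False
      then show ?thesis using c \<open>e < ne p\<close> un
        by (subst owners_Vertex[OF wf]) auto
    qed
  next
    case False
    then show ?thesis using e by (subst owners_Vertex[OF wf]) (auto simp: owners_new[OF wf])
  qed
  have 1: "length (inc ?q v) = 3 \<and> distinct (inc ?q v) \<and> set (inc ?q v) \<subseteq> {..<ne ?q}"
    if "v < nv ?q" for v
  proof (cases "v = nv p")
    case True
    have "set (take t (str p)) \<subseteq> {..<ne p}" using sub un by blast
    then show ?thesis using t d True by (auto)
  next
    case False
    then have "v < nv p" using that by simp
    then have "set (inc p v) \<subseteq> {..<ne p}" "length (inc p v) = 3" "distinct (inc p v)"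
      using wf by (auto simp: wf_pole_def)
    then show ?thesis using False by auto
  qed
  have 2: "distinct (str ?q)" "set (str ?q) \<subseteq> {..<ne ?q}"
    using d sub un by auto
  show ?thesis unfolding Vertex wf_pole_def using 1 2 ow by blast
qed

section \<open>Counting colourings\<close>

definition colourings :: "pole \<Rightarrow> nat list \<Rightarrow> (nat \<Rightarrow> nat) set" where
  "colourings p b = {c \<in> {..<ne p} \<rightarrow>\<^sub>E {..<3}.
     (\<forall>v < nv p. distinct (map c (inc p v))) \<and> map c (str p) = b}"

lemma finite_colourings [simp]: "finite (colourings p b)"
  by (rule finite_subset[of _ "{..<ne p} \<rightarrow>\<^sub>E {..<3}"]) (auto simp: colourings_def finite_PiE)

definition colour_lists :: "nat \<Rightarrow> nat list \<Rightarrow> nat list set" where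
  "colour_lists t used = {xs. length xs = t \<and> set xs \<subseteq> {..<3} \<and> distinct xs \<and> set xs \<inter> set used = {}}"

lemma finite_colour_lists [simp]: "finite (colour_lists t used)"
  by (rule finite_subset[OF _ finite_lists_length_eq[of "{..<3}" t]]) (auto simp: colour_lists_def)

lemma colourings_Pull:
  assumes "k < length (str p)" "length xs = length (str p) - 1"
  shows "colourings (extend (Pull k) p) (x # xs) = colourings p (take k xs @ x # drop k xs)"
proof -
  have "map c (pull k (str p)) = x # xs \<longleftrightarrow> map c (str p) = take k xs @ x # drop k xs" for c
    using assms by (simp add: map_pull pull_eq_Cons_iff)
  then show ?thesis by (simp add: colourings_def)
qed

lemma colourings_Vertex_empty:
  assumes "\<not> distinct ys" "length ys = 3 - t"
  shows "colourings (extend (Vertex t) p) (ys @ rest) = {}"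
proof (rule equals0I)
  fix c assume c: "c \<in> colourings (extend (Vertex t) p) (ys @ rest)"
  then have 1: "distinct (map c (take t (str p) @ [ne p..<ne p + (3 - t)]))"
    by (auto simp: colourings_def simp del: map_append dest: spec[of _ "nv p"])
  from c have 2: "map c [ne p..<ne p + (3 - t)] @ map c (drop t (str p)) = ys @ rest"
    by (auto simp: colourings_def)
  from 2 assms(2) have "map c [ne p..<ne p + (3 - t)] = ys" by (subst (asm) append_eq_append_conv) auto
  with 1 assms(1) show False by simp
qed

text \<open>Restricting to the old edges loses nothing, because the boundary \<open>ys\<close>
  prescribes the colours of the new edges. The new vertex then demands only that the consumed
  strands carry the colours missing from \<open>ys\<close>, in any order.\<close>

lemma card_colourings_Vertex:
  assumes wf: "wf_pole p" and t: "t \<le> 3" "t \<le> length (str p)"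
    and ys: "distinct ys" "length ys = 3 - t" "set ys \<subseteq> {..<3}"
  shows "card (colourings (extend (Vertex t) p) (ys @ rest)) =
    (\<Sum>xs\<in>colour_lists t ys. card (colourings p (xs @ rest)))"
proof -
  define m where "m = ne p"
  let ?k = "3 - t" and ?q = "extend (Vertex t) p"
  define ext where "ext c = (\<lambda>e. if e < m then c e else if e < m + ?k then ys ! (e - m) else undefined)"
    for c :: "nat \<Rightarrow> nat"
  have sub: "set (str p) \<subseteq> {..<m}" using wf by (auto simp: wf_pole_def m_def)
  have subt: "set (take t (str p)) \<subseteq> {..<m}" "set (drop t (str p)) \<subseteq> {..<m}"
    using sub by (meson set_take_subset set_drop_subset subset_trans)+
  have subi: "set (inc p v) \<subseteq> {..<m}" if "v < nv p" for v using wf that by (auto simp: wf_pole_def m_def)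
  have extnew: "map (ext c) [m..<m + ?k] = ys" for c
    by (rule nth_equalityI) (auto simp: ext_def ys)
  have extold: "map (ext c) xs = map c xs" if "set xs \<subseteq> {..<m}" for c xs
    using that by (auto simp: ext_def)
  have resold: "map (restrict c {..<m}) xs = map c xs" if "set xs \<subseteq> {..<m}" for c :: "nat \<Rightarrow> nat" and xs
    using that by auto
  have split: "map c [m..<m + ?k] = ys \<and> map c (drop t (str p)) = rest"
    if "c \<in> colourings ?q (ys @ rest)" for c
  proof -
    have "map c [m..<m + ?k] @ map c (drop t (str p)) = ys @ rest"
      using that by (simp add: colourings_def m_def)
    then show ?thesis using ys by (subst (asm) append_eq_append_conv) auto
  qed
  have td: "map c (str p) = map c (take t (str p)) @ map c (drop t (str p))" for c :: "nat \<Rightarrow> nat"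
    by (metis append_take_drop_id map_append)
  let ?B = "\<Union>xs\<in>colour_lists t ys. colourings p (xs @ rest)"
  have "bij_betw (\<lambda>c. restrict c {..<m}) (colourings ?q (ys @ rest)) ?B"
  proof (rule bij_betw_byWitness[where f' = ext])
    show "\<forall>c\<in>colourings ?q (ys @ rest). ext (restrict c {..<m}) = c"
    proof
      fix c assume c: "c \<in> colourings ?q (ys @ rest)"
      have n: "map c [m..<m + ?k] = ys" using split[OF c] by simp
      have "ys ! (e - m) = c e" if "\<not> e < m" "e < m + ?k" for e
        using that n[symmetric] by (simp add: nth_upt)
      moreover have "c e = undefined" if "\<not> e < m + ?k" for e
        using c that by (auto simp: colourings_def m_def PiE_def extensional_def)
      ultimately show "ext (restrict c {..<m}) = c" by (auto simp: ext_def fun_eq_iff)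
    qed
    show "\<forall>c\<in>?B. restrict (ext c) {..<m} = c"
      by (auto simp: ext_def colourings_def m_def PiE_def extensional_def fun_eq_iff)
    show "(\<lambda>c. restrict c {..<m}) ` colourings ?q (ys @ rest) \<subseteq> ?B"
    proof (rule image_subsetI)
      fix c assume c: "c \<in> colourings ?q (ys @ rest)"
      let ?xs = "map c (take t (str p))"
      have cr: "c e < 3" if "e < m + ?k" for e using c that by (auto simp: colourings_def m_def)
      have "distinct (map c (take t (str p) @ [m..<m + ?k]))"
        using c by (auto simp: colourings_def m_def simp del: map_append dest: spec[of _ "nv p"])
      hence d: "distinct (?xs @ ys)" using split[OF c] by (simp del: map_map)
      have "set ?xs \<subseteq> {..<3}" using subt cr by force
      hence 1: "?xs \<in> colour_lists t ys" using d t by (auto simp: colour_lists_def)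
      have dd: "distinct (map c (inc p v))" if "v < nv p" for v
      proof -
        have "\<forall>v < nv ?q. distinct (map c (inc ?q v))" using c by (simp add: colourings_def)
        moreover have "v < nv ?q" "inc ?q v = inc p v" using that by simp_all
        ultimately show ?thesis by metis
      qed
      have "map (restrict c {..<m}) (str p) = ?xs @ rest"
        unfolding resold[OF sub] td[of c] using split[OF c] by blast
      moreover have "distinct (map (restrict c {..<m}) (inc p v))" if "v < nv p" for v
        unfolding resold[OF subi[OF that]] by (rule dd[OF that])
      moreover have "restrict c {..<m} \<in> {..<m} \<rightarrow>\<^sub>E {..<3}" using cr by auto
      ultimately have "restrict c {..<m} \<in> colourings p (?xs @ rest)"
        unfolding colourings_def m_def by blast
      then show "restrict c {..<m} \<in> ?B" using 1 by blast
    qed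
    show "ext ` ?B \<subseteq> colourings ?q (ys @ rest)"
    proof (rule image_subsetI)
      fix c assume "c \<in> ?B"
      then obtain xs where xs: "xs \<in> colour_lists t ys" and c: "c \<in> colourings p (xs @ rest)" by blast
      have l: "length xs = t" using xs by (simp add: colour_lists_def)
      have "map c (take t (str p)) @ map c (drop t (str p)) = xs @ rest"
        using c td[of c] by (simp add: colourings_def)
      hence xr: "map c (take t (str p)) = xs" "map c (drop t (str p)) = rest"
        using l t by (auto simp: append_eq_append_conv)
      have "ys ! (e - m) < 3" if "\<not> e < m" "e < m + ?k" for e
      proof -
        have "e - m < length ys" using that ys by simp
        then have "ys ! (e - m) \<in> set ys" by (rule nth_mem)
        then show ?thesis using ys(3) by blast
      qed
      hence P: "ext c \<in> {..<m + ?k} \<rightarrow>\<^sub>E {..<3}"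
        using c by (auto simp: ext_def colourings_def m_def PiE_def extensional_def)
      have D: "distinct (map (ext c) (inc ?q v))" if "v < nv ?q" for v
      proof (cases "v = nv p")
        case True
        have "map (ext c) (inc ?q v) = xs @ ys"
          using True extold[OF subt(1)] extnew xr by (simp add: m_def[symmetric] del: map_map map_eq_conv)
        then show ?thesis using xs ys by (auto simp: colour_lists_def)
      next
        case False
        then have v: "v < nv p" using that by simp
        then have "map (ext c) (inc ?q v) = map c (inc p v)"
          using extold[OF subi[OF v]] False by (simp del: map_eq_conv)
        moreover have "distinct (map c (inc p v))" using c v by (simp add: colourings_def)
        ultimately show ?thesis by metis
      qed
      have "map (ext c) (str ?q) = ys @ rest"
        using extold[OF subt(2)] extnew xr by (simp add: m_def[symmetric] del: map_map map_eq_conv)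
      then show "ext c \<in> colourings ?q (ys @ rest)" using P D by (simp add: colourings_def m_def)
    qed
  qed
  hence "card (colourings ?q (ys @ rest)) = card ?B" by (rule bij_betw_same_card)
  also have "\<dots> = (\<Sum>xs\<in>colour_lists t ys. card (colourings p (xs @ rest)))"
  proof (rule card_UN_disjoint)
    show "\<forall>i\<in>colour_lists t ys. \<forall>j\<in>colour_lists t ys. i \<noteq> j \<longrightarrow>
        colourings p (i @ rest) \<inter> colourings p (j @ rest) = {}"
      by (auto simp: colourings_def)
  qed auto
  finally show ?thesis .
qed

section \<open>Numbers of colourings as ternary tries\<close>

datatype ctree = CZ | CL nat | CN ctree ctree ctree

fun ckid :: "nat \<Rightarrow> ctree \<Rightarrow> ctree" where
  "ckid i (CN a b c) = (if i = 0 then a else if i = 1 then b else c)"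
| "ckid i _ = CZ"

fun clookup :: "ctree \<Rightarrow> nat list \<Rightarrow> nat" where
  "clookup t [] = (case t of CL n \<Rightarrow> n | _ \<Rightarrow> 0)"
| "clookup t (x # xs) = clookup (ckid x t) xs"

text \<open>\<open>CZ\<close> is the zero table of every depth. The predicate rules out arguments of
  different shape, for which the last equation of \<open>cadd\<close> would drop a summand.\<close>

fun cdepth :: "nat \<Rightarrow> ctree \<Rightarrow> bool" where
  "cdepth n CZ \<longleftrightarrow> True"
| "cdepth n (CL k) \<longleftrightarrow> n = 0"
| "cdepth n (CN a b c) \<longleftrightarrow> (case n of 0 \<Rightarrow> False | Suc m \<Rightarrow> cdepth m a \<and> cdepth m b \<and> cdepth m c)"

fun cadd :: "ctree \<Rightarrow> ctree \<Rightarrow> ctree" where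
  "cadd CZ u = u"
| "cadd (CL m) (CL n) = CL (m + n)"
| "cadd (CN a b c) (CN a' b' c') = CN (cadd a a') (cadd b b') (cadd c c')"
| "cadd t u = t"

fun cscale :: "nat \<Rightarrow> ctree \<Rightarrow> ctree" where
  "cscale k CZ = CZ"
| "cscale k (CL n) = CL (k * n)"
| "cscale k (CN a b c) = CN (cscale k a) (cscale k b) (cscale k c)"

text \<open>Collapsing zero nodes keeps the tries small and lets the tables before and after a block
  be compared as plain terms.\<close>

definition cnode :: "ctree \<Rightarrow> ctree \<Rightarrow> ctree \<Rightarrow> ctree" where
  "cnode a b c = (if a = CZ \<and> b = CZ \<and> c = CZ then CZ else CN a b c)"

fun csum :: "nat \<Rightarrow> nat list \<Rightarrow> ctree \<Rightarrow> ctree" where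
  "csum 0 used t = t"
| "csum (Suc k) used t = cadd (if 0 \<in> set used then CZ else csum k (0 # used) (ckid 0 t))
     (cadd (if 1 \<in> set used then CZ else csum k (1 # used) (ckid 1 t))
           (if 2 \<in> set used then CZ else csum k (2 # used) (ckid 2 t)))"

text \<open>\<open>used\<close> carries the colours already chosen at the new vertex: first for its
  \<open>k\<close> new strands, which become levels of the result, then for the \<open>t\<close>
  consumed strands, whose levels are summed away.\<close>

fun cbuild :: "nat \<Rightarrow> nat \<Rightarrow> nat list \<Rightarrow> ctree \<Rightarrow> ctree" where
  "cbuild 0 t used T = csum t used T"
| "cbuild (Suc k) t used T = cnode (if 0 \<in> set used then CZ else cbuild k t (0 # used) T)
     (if 1 \<in> set used then CZ else cbuild k t (1 # used) T)
     (if 2 \<in> set used then CZ else cbuild k t (2 # used) T)"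

text \<open>The wanted level is first brought to the top of each subtrie, and then the two top
  levels are transposed.\<close>

fun cpull :: "nat \<Rightarrow> ctree \<Rightarrow> ctree" where
  "cpull 0 t = t"
| "cpull (Suc k) t = (let a = cpull k (ckid 0 t); b = cpull k (ckid 1 t); c = cpull k (ckid 2 t) in
     cnode (cnode (ckid 0 a) (ckid 0 b) (ckid 0 c)) (cnode (ckid 1 a) (ckid 1 b) (ckid 1 c))
           (cnode (ckid 2 a) (ckid 2 b) (ckid 2 c)))"

fun cstep :: "step \<Rightarrow> ctree \<Rightarrow> ctree" where
  "cstep (Pull k) T = cpull k T"
| "cstep (Vertex t) T = cbuild (3 - t) t [] T"

lemma ckid_cnode [simp]: "ckid i (cnode a b c) = (if i = 0 then a else if i = 1 then b else c)"
  by (simp add: cnode_def)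

lemma clookup_CZ [simp]: "clookup CZ xs = 0"
  by (induction xs) auto

lemma cdepth_ckid [simp]: "cdepth (Suc n) t \<Longrightarrow> cdepth n (ckid i t)"
  by (cases t) auto

lemma cdepth_cnode [simp]: "cdepth n a \<Longrightarrow> cdepth n b \<Longrightarrow> cdepth n c \<Longrightarrow> cdepth (Suc n) (cnode a b c)"
  by (simp add: cnode_def)

lemma cdepth_cadd [simp]: "cdepth n t \<Longrightarrow> cdepth n u \<Longrightarrow> cdepth n (cadd t u)"
  by (induction t u arbitrary: n rule: cadd.induct) (auto split: nat.splits)

lemma clookup_cadd:
  "cdepth n t \<Longrightarrow> cdepth n u \<Longrightarrow> clookup (cadd t u) xs = clookup t xs + clookup u xs"
proof (induction t u arbitrary: n xs rule: cadd.induct)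
  case (2 m k) then show ?case by (cases xs) auto
next
  case (3 a b c a' b' c') then show ?case by (cases xs; cases n) auto
qed auto

lemma clookup_cscale: "clookup (cscale k t) xs = k * clookup t xs"
proof (induction t arbitrary: xs)
  case (CL x) then show ?case by (cases xs) auto
next
  case (CN a b c) then show ?case by (cases xs) auto
qed auto

lemma cdepth_csum: "cdepth (k + n) t \<Longrightarrow> cdepth n (csum k used t)"
  by (induction k arbitrary: used t) auto

lemma colour_lists_Suc:
  "colour_lists (Suc k) used = (\<Union>c\<in>{..<3} - set used. (#) c ` colour_lists k (c # used))"
  by (auto simp: colour_lists_def length_Suc_conv)

lemma clookup_csum:
  "cdepth (k + n) t \<Longrightarrow> clookup (csum k used t) rest = (\<Sum>xs\<in>colour_lists k used. clookup t (xs @ rest))"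
proof (induction k arbitrary: used t)
  case 0
  have "colour_lists 0 used = {[]}" by (auto simp: colour_lists_def)
  then show ?case by simp
next
  case (Suc k)
  let ?f = "\<lambda>c. if c \<in> set used then 0 else \<Sum>xs\<in>colour_lists k (c # used). clookup t ((c # xs) @ rest)"
  have d: "cdepth (k + n) (ckid i t)" for i using Suc.prems by simp
  have d': "cdepth n (csum k u (ckid i t))" for u i using d by (rule cdepth_csum)
  have "clookup (csum (Suc k) used t) rest = ?f 0 + (?f 1 + ?f 2)"
    using d' Suc.IH[OF d] by (simp add: clookup_cadd[where n = n])
  also have "\<dots> = (\<Sum>c\<in>{..<3}. ?f c)" by (simp add: numeral_3_eq_3 numeral_2_eq_2)
  also have "\<dots> = (\<Sum>c\<in>{..<3} - set used. \<Sum>xs\<in>colour_lists k (c # used). clookup t ((c # xs) @ rest))"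
    by (rule sum.mono_neutral_cong_right) auto
  also have "\<dots> = (\<Sum>c\<in>{..<3} - set used. \<Sum>xs\<in>(#) c ` colour_lists k (c # used). clookup t (xs @ rest))"
    by (subst sum.reindex) auto
  also have "\<dots> = (\<Sum>xs\<in>colour_lists (Suc k) used. clookup t (xs @ rest))"
    unfolding colour_lists_Suc by (rule sum.UNION_disjoint[symmetric]) auto
  finally show ?case .
qed

lemma cdepth_cbuild: "cdepth (t + n) T \<Longrightarrow> cdepth (k + n) (cbuild k t used T)"
  by (induction k arbitrary: used) (auto simp: cdepth_csum)

lemma nat_less_3: "(x::nat) < 3 \<longleftrightarrow> x = 0 \<or> x = 1 \<or> x = 2"
  by auto

lemma clookup_cbuild:
  "set ys \<subseteq> {..<3} \<Longrightarrow>
   clookup (cbuild (length ys) t used T) (ys @ rest) =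
     (if distinct ys \<and> set ys \<inter> set used = {} then clookup (csum t (rev ys @ used) T) rest else 0)"
proof (induction ys arbitrary: used)
  case (Cons y ys)
  then have y: "y = 0 \<or> y = 1 \<or> y = 2" by (auto simp: nat_less_3)
  have IH: "clookup (cbuild (length ys) t (y # used) T) (ys @ rest) =
      (if distinct ys \<and> set ys \<inter> set (y # used) = {}
       then clookup (csum t (rev ys @ y # used) T) rest else 0)"
    using Cons.prems by (intro Cons.IH) simp
  have "clookup (cbuild (length (y # ys)) t used T) ((y # ys) @ rest) =
      (if y \<in> set used then 0 else clookup (cbuild (length ys) t (y # used) T) (ys @ rest))"
    using y by (elim disjE) simp_all
  then show ?case unfolding IH by simp
qed simp

lemma cdepth_cpull: "k < n \<Longrightarrow> cdepth n t \<Longrightarrow> cdepth n (cpull k t)"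
proof (induction k arbitrary: n t)
  case (Suc k)
  then obtain m where m: "n = Suc (Suc m)" by (metis Suc_lessE less_Suc_eq_0_disj not_less0 less_imp_Suc_add)
  have "cdepth (Suc m) (cpull k (ckid i t))" for i using Suc m by simp
  then show ?case using m by (simp add: Let_def)
qed simp

lemma clookup_cpull:
  "k \<le> length xs \<Longrightarrow> set (x # xs) \<subseteq> {..<3} \<Longrightarrow>
   clookup (cpull k t) (x # xs) = clookup t (take k xs @ x # drop k xs)"
proof (induction k arbitrary: t xs)
  case (Suc k)
  then obtain y ys where xs: "xs = y # ys" by (cases xs) auto
  have "clookup (cpull (Suc k) t) (x # y # ys) = clookup (cpull k (ckid y t)) (x # ys)"
    using Suc.prems xs by (auto simp: Let_def nat_less_3)
  also have "\<dots> = clookup t (take (Suc k) xs @ x # drop (Suc k) xs)"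
    using Suc.IH[of ys "ckid y t"] Suc.prems xs by simp
  finally show ?case by (simp only: xs)
qed simp

definition counts :: "pole \<Rightarrow> nat \<Rightarrow> ctree \<Rightarrow> bool" where
  "counts p n T \<longleftrightarrow> cdepth (length (str p)) T \<and>
     (\<forall>b. length b = length (str p) \<longrightarrow> set b \<subseteq> {..<3} \<longrightarrow> card (colourings p b) = n * clookup T b)"

lemma counts_extend:
  assumes wf: "wf_pole p" and app: "applicable s (length (str p))" and cn: "counts p n T"
  shows "counts (extend s p) n (cstep s T)"
proof (cases s)
  case (Pull k)
  then have k: "k < length (str p)" using app by simp
  have "card (colourings (extend s p) b) = n * clookup (cpull k T) b"
    if b0: "length b = length (str p)" "set b \<subseteq> {..<3}" for b
  proof -
    obtain x xs where b: "b = x # xs" using k b0 by (cases b) auto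
    have "set (take k xs @ x # drop k xs) \<subseteq> {..<3}"
      using b0 b by (metis append_take_drop_id insert_is_Un list.simps(15) set_append Un_left_commute)
    then show ?thesis
      using Pull k b0 b cn by (simp add: colourings_Pull clookup_cpull counts_def del: extend.simps clookup.simps)
  qed
  then show ?thesis using Pull k cn by (simp add: counts_def length_pull cdepth_cpull)
next
  case (Vertex t)
  have t: "t \<le> 3" "t \<le> length (str p)" using app Vertex by auto
  let ?n = "length (str p) - t"
  have dT: "cdepth (t + ?n) T" using cn t by (simp add: counts_def)
  have "card (colourings (extend s p) b) = n * clookup (cstep s T) b"
    if b: "length b = 3 - t + ?n" "set b \<subseteq> {..<3}" for b
  proof -
    obtain ys rest where yr: "b = ys @ rest" "length ys = 3 - t" "length rest = ?n"
      using b(1) by (metis append_take_drop_id length_drop length_take add_diff_cancel_left' min.absorb2 le_add1)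
    have s: "set ys \<subseteq> {..<3}" "set rest \<subseteq> {..<3}" using yr b by auto
    show ?thesis
    proof (cases "distinct ys")
      case True
      have "card (colourings (extend s p) b) = (\<Sum>xs\<in>colour_lists t ys. card (colourings p (xs @ rest)))"
        using Vertex yr True s by (simp add: card_colourings_Vertex[OF wf t] del: extend.simps)
      also have "\<dots> = (\<Sum>xs\<in>colour_lists t ys. n * clookup T (xs @ rest))"
        using cn yr s t by (intro sum.cong) (auto simp: counts_def colour_lists_def)
      \<comment> \<open>\<open>cbuild\<close> collects the chosen colours in reverse;
        \<open>colour_lists\<close> depends only on their set.\<close>
      also have "\<dots> = n * (\<Sum>xs\<in>colour_lists t (rev ys). clookup T (xs @ rest))"
        by (simp add: sum_distrib_left colour_lists_def)
      also have "\<dots> = n * clookup (csum t (rev ys) T) rest"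
        using dT by (simp add: clookup_csum)
      also have "\<dots> = n * clookup (cstep s T) b"
        using clookup_cbuild[OF s(1), of t "[]" T rest] True yr Vertex by simp
      finally show ?thesis .
    next
      case False
      then show ?thesis
        using clookup_cbuild[OF s(1), of t "[]" T rest] yr Vertex
        by (simp add: colourings_Vertex_empty del: extend.simps)
    qed
  qed
  then show ?thesis using Vertex cdepth_cbuild[OF dT, of "3 - t" "[]"]
    by (simp add: counts_def)
qed

section \<open>Edge cuts\<close>

definition touches :: "pole \<Rightarrow> nat set \<Rightarrow> nat \<Rightarrow> bool" where
  "touches p S e \<longleftrightarrow> owners p e \<inter> S \<noteq> {}"

text \<open>A strand has a single owner and is therefore never a cut edge. It can become one only
  when a vertex is attached to its free end.\<close>

definition cut :: "pole \<Rightarrow> nat set \<Rightarrow> nat set" where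
  "cut p S = {e. owners p e \<inter> S \<noteq> {} \<and> owners p e - S \<noteq> {}}"

text \<open>Whether a side contains a cycle cannot be followed locally, but whether it contains an
  edge can. Nothing is lost: in a loopless cubic graph, a vertex set inducing a forest with k
  vertices and c components is left by k + 2c edges, which is at least 4 as soon as there is an
  edge. So four cut edges whenever both sides contain an edge is equivalent to four whenever both
  sides contain a cycle.\<close>

definition inner_edge :: "pole \<Rightarrow> nat set \<Rightarrow> bool" where
  "inner_edge p S \<longleftrightarrow> (\<exists>e u v. u \<in> owners p e \<inter> S \<and> v \<in> owners p e \<inter> S \<and> u \<noteq> v)"

text \<open>
  \<open>BL w x y z\<close> holds lower bounds for the number of cut edges of a vertex set \<open>S\<close>: \<open>w\<close> for every
  \<open>S\<close>, \<open>x\<close> if \<open>S\<close> contains an edge, \<open>y\<close> if its complement does, \<open>z\<close> if both do. A branch of a \<open>BN\<close> node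
  says on which side of the cut a strand lies, and \<open>BX\<close> marks combinations that no \<open>S\<close> realises.
\<close>

datatype btree = BX | BL nat nat nat nat | BN btree btree

fun bkid :: "bool \<Rightarrow> btree \<Rightarrow> btree" where
  "bkid s BX = BX"
| "bkid s (BL w x y z) = BL 0 0 0 0"
| "bkid s (BN l r) = (if s then r else l)"

text \<open>\<open>d\<close> is an actual number of cut edges, \<open>ss\<close> gives the sides of
  the strands, and \<open>a\<close> and \<open>b\<close> announce an edge in the set and in its
  complement. If the depth of the trie does not fit the list, a \<open>BL\<close> or
  \<open>BN\<close> claims nothing.\<close>

fun admits :: "btree \<Rightarrow> bool list \<Rightarrow> bool \<Rightarrow> bool \<Rightarrow> nat \<Rightarrow> bool" where
  "admits t [] a b d \<longleftrightarrow> (case t of BX \<Rightarrow> False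
     | BL w x y z \<Rightarrow> (if a then if b then z else x else if b then y else w) \<le> d
     | BN l r \<Rightarrow> True)"
| "admits t (s # ss) a b d \<longleftrightarrow> admits (bkid s t) ss a b d"

fun bmin :: "btree \<Rightarrow> btree \<Rightarrow> btree" where
  "bmin BX u = u"
| "bmin t BX = t"
| "bmin (BL w x y z) (BL w' x' y' z') = BL (min w w') (min x x') (min y y') (min z z')"
| "bmin (BN l r) (BN l' r') = BN (bmin l l') (bmin r r')"
| "bmin t u = BL 0 0 0 0"

definition bnode :: "btree \<Rightarrow> btree \<Rightarrow> btree" where
  "bnode l r = (if l = BX \<and> r = BX then BX else BN l r)"

text \<open>The new vertex lies on side \<open>s\<close>, \<open>c\<close> counts the consumed
  strands from the other side, and \<open>u\<close> says that one comes from the same side. If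
  \<open>u\<close> holds, side \<open>s\<close> now contains an edge whether or not it did before,
  so the weaker old bounds must serve: \<open>w\<close> and \<open>y\<close> replace
  \<open>x\<close> and \<open>z\<close> if \<open>s\<close> is true, and \<open>w\<close> and
  \<open>x\<close> replace \<open>y\<close> and \<open>z\<close> otherwise.\<close>

fun bupdate :: "bool \<Rightarrow> nat \<Rightarrow> bool \<Rightarrow> btree \<Rightarrow> btree" where
  "bupdate s c u BX = BX"
| "bupdate s c u (BL w x y z) =
     (if u then if s then BL (w + c) (w + c) (y + c) (y + c) else BL (w + c) (x + c) (w + c) (x + c)
      else BL (w + c) (x + c) (y + c) (z + c))"
| "bupdate s c u (BN l r) = BN (bupdate s c u l) (bupdate s c u r)"

fun bgather :: "bool \<Rightarrow> nat \<Rightarrow> nat \<Rightarrow> bool \<Rightarrow> btree \<Rightarrow> btree" where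
  "bgather s 0 c u t = bupdate s c u t"
| "bgather s (Suc k) c u t =
     bmin (bgather s k (if s then Suc c else c) (u \<or> \<not> s) (bkid False t))
          (bgather s k (if s then c else Suc c) (u \<or> s) (bkid True t))"

text \<open>The new strands all belong to the new vertex and lie on its side, so every other branch
  is impossible.\<close>

fun bspread :: "bool \<Rightarrow> nat \<Rightarrow> btree \<Rightarrow> btree" where
  "bspread s 0 t = t"
| "bspread s (Suc k) t = (if s then bnode BX (bspread s k t) else bnode (bspread s k t) BX)"

fun bpull :: "nat \<Rightarrow> btree \<Rightarrow> btree" where
  "bpull 0 t = t"
| "bpull (Suc k) t = (let l = bpull k (bkid False t); r = bpull k (bkid True t) in
     bnode (bnode (bkid False l) (bkid False r)) (bnode (bkid True l) (bkid True r)))"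

fun bstep :: "step \<Rightarrow> btree \<Rightarrow> btree" where
  "bstep (Pull k) t = bpull k t"
| "bstep (Vertex j) t =
     bmin (bspread False (3 - j) (bgather False j 0 False t)) (bspread True (3 - j) (bgather True j 0 False t))"

lemma bkid_bnode [simp]: "bkid s (bnode l r) = (if s then r else l)"
  by (simp add: bnode_def)

lemma admits_zero [simp]: "admits (BL 0 0 0 0) ss a b d"
  by (induction ss) auto

lemma admits_BX [simp]: "\<not> admits BX ss a b d"
  by (induction ss) auto

lemma admits_bmin:
  "admits t ss a b d \<or> admits u ss a b d \<Longrightarrow> admits (bmin t u) ss a b d"
proof (induction t u arbitrary: ss rule: bmin.induct)
  case (3 w x y z w' x' y' z')
  then show ?case by (cases ss) (auto split: if_splits)
next
  case (4 l r l' r')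
  then show ?case by (cases ss) auto
qed auto

text \<open>If \<open>u\<close> holds, the edge at the new vertex justifies the flag of side
  \<open>s\<close>, and the premise must not demand it of the old set.\<close>

lemma admits_bupdate:
  assumes "admits t ss (a \<and> \<not> (u \<and> s)) (b \<and> \<not> (u \<and> \<not> s)) d"
  shows "admits (bupdate s c u t) ss a b (d + c)"
  using assms
proof (induction t arbitrary: ss)
  case (BL w x y z)
  then show ?case by (cases ss) (auto split: if_splits)
next
  case (BN l r)
  then show ?case by (cases ss) auto
qed auto

lemma admits_bgather:
  assumes "admits t (xs @ ss) (a \<and> \<not> ((u \<or> s \<in> set xs) \<and> s)) (b \<and> \<not> ((u \<or> s \<in> set xs) \<and> \<not> s)) d"
  shows "admits (bgather s (length xs) c u t) ss a b (d + c + length (filter (\<lambda>x. x \<noteq> s) xs))"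
  using assms
proof (induction xs arbitrary: c u t)
  case Nil
  then show ?case by (simp add: admits_bupdate)
next
  case (Cons x xs)
  let ?c = "if x = s then c else Suc c" and ?u = "u \<or> x = s"
  have "admits (bgather s (length xs) ?c ?u (bkid x t)) ss a b
      (d + ?c + length (filter (\<lambda>x. x \<noteq> s) xs))"
    using Cons.prems by (intro Cons.IH) (cases "x = s"; auto)
  then show ?case by (cases x; cases s) (auto intro!: admits_bmin)
qed

lemma admits_bspread: "admits t ss a b d \<Longrightarrow> admits (bspread s k t) (replicate k s @ ss) a b d"
  by (induction k) auto

lemma admits_bpull:
  "k \<le> length ss \<Longrightarrow> admits (bpull k t) (s # ss) a b d = admits t (take k ss @ s # drop k ss) a b d"
proof (induction k arbitrary: t ss)
  case (Suc k)
  then obtain x xs where ss: "ss = x # xs" by (cases ss) auto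
  have "admits (bpull (Suc k) t) (s # x # xs) a b d = admits (bpull k (bkid x t)) (s # xs) a b d"
    by (cases s; cases x) (simp_all add: Let_def)
  also have "\<dots> = admits t (take (Suc k) ss @ s # drop (Suc k) ss) a b d"
    using Suc ss by simp
  finally show ?case by (simp only: ss)
qed simp

text \<open>The flags only imply the existence of edges. A false flag therefore suits every set,
  which is what is needed when a flag is dropped for the old set.\<close>

definition cut_bound :: "pole \<Rightarrow> btree \<Rightarrow> bool" where
  "cut_bound p K \<longleftrightarrow> (\<forall>S a b. S \<subseteq> {..<nv p} \<longrightarrow> (a \<longrightarrow> inner_edge p S) \<longrightarrow>
     (b \<longrightarrow> inner_edge p ({..<nv p} - S)) \<longrightarrow>
     admits K (map (touches p S) (str p)) a b (card (cut p S)))"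

lemma owner_unique:
  assumes "wf_pole p" "e \<in> set (str p)"
  obtains v where "owners p e = {v}" "v < nv p"
proof -
  have "card (owners p e) = 1" using assms by (auto simp: wf_pole_def)
  then obtain v where v: "owners p e = {v}" by (rule card_1_singletonE)
  then have "v \<in> owners p e" by simp
  then show ?thesis using that v by (auto simp: owners_def)
qed

lemma finite_cut: "wf_pole p \<Longrightarrow> finite (cut p S)"
proof -
  assume wf: "wf_pole p"
  have "cut p S \<subseteq> {..<ne p}"
    using owners_new[OF wf] by (auto simp: cut_def not_le[symmetric])
  then show ?thesis by (rule finite_subset) simp
qed

lemma cut_bound_extend:
  assumes wf: "wf_pole p" and app: "applicable s (length (str p))" and K: "cut_bound p K"
  shows "cut_bound (extend s p) (bstep s K)"
proof (cases s)
  case (Pull k)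
  have k: "k < length (str p)" using app Pull by simp
  have eq: "touches (extend s p) = touches p" "cut (extend s p) = cut p"
    "inner_edge (extend s p) = inner_edge p"
    using Pull by (auto simp: touches_def cut_def inner_edge_def fun_eq_iff simp del: extend.simps)
  have "admits (bpull k K) (map f (pull k (str p))) a b d = admits K (map f (str p)) a b d" for f a b d
  proof -
    obtain y ys where y: "map f (pull k (str p)) = y # ys"
      using k by (cases "map f (pull k (str p))") (auto simp: pull_def)
    then have y2: "length ys = length (str p) - 1" "map f (str p) = take k ys @ y # drop k ys"
      using k by (auto simp: map_pull pull_eq_Cons_iff)
    show ?thesis unfolding y y2(2) by (rule admits_bpull) (use k y2 in auto)
  qed
  then show ?thesis using K unfolding cut_bound_def eq using Pull by simp
next
  case (Vertex t)
  have t: "t \<le> 3" "t \<le> length (str p)" using app Vertex by auto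
  let ?q = "extend (Vertex t) p" and ?N = "nv p" and ?xs = "take t (str p)"
  have dis: "distinct (str p)" and sub: "set (str p) \<subseteq> {..<ne p}" using wf by (auto simp: wf_pole_def)
  have subx: "set ?xs \<subseteq> set (str p)" by (rule set_take_subset)
  have disj: "set ?xs \<inter> set (drop t (str p)) = {}"
    using dis by (metis append_take_drop_id distinct_append)
  have "admits (bstep s K) (map (touches ?q S') (str ?q)) a b (card (cut ?q S'))"
    if S': "S' \<subseteq> {..<nv ?q}" and a: "a \<longrightarrow> inner_edge ?q S'"
      and b: "b \<longrightarrow> inner_edge ?q ({..<nv ?q} - S')" for S' a b
  proof -
    define S where "S = S' - {?N}"
    define x where "x = (?N \<in> S')"
    have S: "S \<subseteq> {..<?N}" using S' by (auto simp: S_def)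
    let ?new = "{e. ne p \<le> e \<and> e < ne p + (3 - t)}"
    have tq: "touches ?q S' e \<longleftrightarrow> touches p S e \<or> (x \<and> (e \<in> set ?xs \<or> e \<in> ?new))" for e
    proof -
      have "\<And>U. insert ?N U \<inter> S' \<noteq> {} \<longleftrightarrow> U \<inter> S \<noteq> {} \<or> x"
        "\<And>U. ?N \<notin> U \<Longrightarrow> U \<inter> S' \<noteq> {} \<longleftrightarrow> U \<inter> S \<noteq> {}"
        unfolding S_def x_def by auto
      then show ?thesis
        by (auto simp add: touches_def owners_Vertex[OF wf] x_def[symmetric] simp del: extend.simps)
    qed
    have single: "\<exists>v. owners p e = {v} \<and> v < ?N" if "e \<in> set ?xs" for e
      using owner_unique[OF wf] that subx by blast
    \<comment> \<open>A consumed strand gains the new vertex as its second owner, and all other old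
      edges keep their owners. So the additional cut edges are the consumed strands whose old owner
      lies opposite to the new vertex.\<close>
    have cq: "cut ?q S' = cut p S \<union> {e \<in> set ?xs. touches p S e \<noteq> x}"
    proof (rule set_eqI)
      fix e
      show "e \<in> cut ?q S' \<longleftrightarrow> e \<in> cut p S \<union> {e \<in> set ?xs. touches p S e \<noteq> x}"
      proof (cases "e \<in> set ?xs")
        case True
        then obtain v where v: "owners p e = {v}" "v < ?N" using single by blast
        have "owners ?q e = {?N, v}" using True v by (simp add: owners_Vertex[OF wf] del: extend.simps)
        then show ?thesis using True v unfolding cut_def touches_def S_def x_def by auto
      next
        case False
        have "?N \<notin> owners p e" by simp
        then have "owners p e \<inter> S = owners p e \<inter> S'" "owners p e - S = owners p e - S'"
          by (auto simp: S_def)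
        moreover have "owners ?q e = owners p e \<or> owners p e = {} \<and> owners ?q e = {?N}"
          using False owners_new[OF wf, of e] by (simp add: owners_Vertex[OF wf] del: extend.simps)
        ultimately show ?thesis using False by (auto simp: cut_def simp del: extend.simps)
      qed
    qed
    have "cut p S \<inter> {e \<in> set ?xs. touches p S e \<noteq> x} = {}"
      using single by (fastforce simp: cut_def)
    then have "card (cut ?q S') = card (cut p S) + card {e \<in> set ?xs. touches p S e \<noteq> x}"
      unfolding cq by (subst card_Un_disjoint) (simp_all add: finite_cut[OF wf])
    also have "card {e \<in> set ?xs. touches p S e \<noteq> x} = length (filter (\<lambda>e. touches p S e \<noteq> x) ?xs)"
      using dis by (metis distinct_card distinct_filter distinct_take set_filter)
    also have "\<dots> = length (filter (\<lambda>b. b \<noteq> x) (map (touches p S) ?xs))"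
      by (simp add: filter_map comp_def)
    finally have card: "card (cut ?q S') = card (cut p S) + 0 + \<dots>" by simp
    \<comment> \<open>A flag survives for the old set only if the new vertex has no consumed strand
      on its own side there; otherwise the edge in question may be that strand.\<close>
    define a' where "a' = (a \<and> \<not> (x \<in> set (map (touches p S) ?xs) \<and> x))"
    define b' where "b' = (b \<and> \<not> (x \<in> set (map (touches p S) ?xs) \<and> \<not> x))"
    have a': "a' \<longrightarrow> inner_edge p S"
    proof
      assume "a'"
      then have "inner_edge ?q S'" and no: "\<not> (x \<and> (\<exists>e\<in>set ?xs. touches p S e))"
        using a by (auto simp: a'_def)
      then obtain e u v where e: "u \<in> owners ?q e \<inter> S'" "v \<in> owners ?q e \<inter> S'" "u \<noteq> v"
        by (auto simp: inner_edge_def simp del: extend.simps)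
      have "\<not> (u = ?N \<or> v = ?N)"
      proof
        assume "u = ?N \<or> v = ?N"
        then obtain w where w: "w \<in> owners ?q e \<inter> S'" "w \<noteq> ?N" and N: "?N \<in> owners ?q e \<inter> S'"
          using e by blast
        then have w': "w \<in> owners p e \<inter> S" "x" by (auto simp: owners_Vertex[OF wf] S_def x_def simp del: extend.simps split: if_splits)
        then have "touches p S e" by (auto simp: touches_def)
        moreover have "e \<in> set ?xs"
          using N w' owners_new[OF wf, of e] by (auto simp: owners_Vertex[OF wf] simp del: extend.simps split: if_splits)
        ultimately show False using no w' by blast
      qed
      then have "u \<in> owners p e \<inter> S" "v \<in> owners p e \<inter> S"
        using e by (auto simp: owners_Vertex[OF wf] S_def simp del: extend.simps split: if_splits)
      then show "inner_edge p S" using e(3) by (auto simp: inner_edge_def)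
    qed
    have b': "b' \<longrightarrow> inner_edge p ({..<?N} - S)"
    proof
      assume "b'"
      then have "inner_edge ?q ({..<nv ?q} - S')" and no: "\<not> (\<not> x \<and> (\<exists>e\<in>set ?xs. \<not> touches p S e))"
        using b by (auto simp: b'_def)
      then obtain e u v where e: "u \<in> owners ?q e - S'" "v \<in> owners ?q e - S'" "u \<noteq> v"
        by (auto simp: inner_edge_def simp del: extend.simps)
      have old: "w \<in> owners p e - S" if "w \<in> owners ?q e - S'" "w \<noteq> ?N" for w
        using that by (auto simp: owners_Vertex[OF wf] S_def simp del: extend.simps split: if_splits)
      have "\<not> (u = ?N \<or> v = ?N)"
      proof
        assume "u = ?N \<or> v = ?N"
        then obtain w where w: "w \<in> owners ?q e - S'" "w \<noteq> ?N" and N: "?N \<in> owners ?q e - S'"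
          using e by blast
        then have x: "\<not> x" by (auto simp: x_def)
        have w': "w \<in> owners p e - S" using old w by blast
        have ex: "e \<in> set ?xs"
          using N w' owners_new[OF wf, of e] by (auto simp: owners_Vertex[OF wf] simp del: extend.simps split: if_splits)
        then obtain w2 where "owners p e = {w2}" using single by blast
        then have "\<not> touches p S e" using w' by (auto simp: touches_def)
        then show False using no x ex by blast
      qed
      then have "u \<in> owners p e - S" "v \<in> owners p e - S" using old e by auto
      then show "inner_edge p ({..<?N} - S)" using e(3) by (auto simp: inner_edge_def owners_def)
    qed
    have "admits K (map (touches p S) (str p)) a' b' (card (cut p S))"
      using K S a' b' by (auto simp: cut_bound_def)
    moreover have "map (touches p S) (str p) = map (touches p S) ?xs @ map (touches p S) (drop t (str p))"
      by (metis append_take_drop_id map_append)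
    ultimately have "admits K (map (touches p S) ?xs @ map (touches p S) (drop t (str p))) a' b' (card (cut p S))"
      by metis
    then have "admits (bgather x (length (map (touches p S) ?xs)) 0 False K)
        (map (touches p S) (drop t (str p))) a b (card (cut ?q S'))"
      unfolding card by (intro admits_bgather) (simp only: a'_def b'_def simp_thms)
    then have *: "admits (bspread x (3 - t) (bgather x t 0 False K))
        (replicate (3 - t) x @ map (touches p S) (drop t (str p))) a b (card (cut ?q S'))"
      using t by (intro admits_bspread) simp
    have "map (touches ?q S') [ne p..<ne p + (3 - t)] = replicate (3 - t) x"
    proof (rule nth_equalityI)
      fix i assume "i < length (map (touches ?q S') [ne p..<ne p + (3 - t)])"
      then have i: "i < 3 - t" by simp
      have "\<not> touches p S (ne p + i)" using owners_new[OF wf, of "ne p + i"] by (simp add: touches_def)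
      then show "map (touches ?q S') [ne p..<ne p + (3 - t)] ! i = replicate (3 - t) x ! i"
        using i tq[of "ne p + i"] by (auto simp del: extend.simps)
    qed simp
    moreover have "map (touches ?q S') (drop t (str p)) = map (touches p S) (drop t (str p))"
    proof (rule map_cong[OF refl])
      fix e assume e: "e \<in> set (drop t (str p))"
      then have "e \<notin> set ?xs" using disj by blast
      moreover have "e \<notin> ?new" using e sub set_drop_subset by fastforce
      ultimately show "touches ?q S' e = touches p S e" using tq by blast
    qed
    ultimately have m: "map (touches ?q S') (str ?q) = replicate (3 - t) x @ map (touches p S) (drop t (str p))"
      by simp
    show ?thesis using * unfolding m Vertex bstep.simps by (cases x) (auto intro: admits_bmin)
  qed
  then show ?thesis unfolding cut_bound_def Vertex by blast
qed

fun bgeq :: "btree \<Rightarrow> btree \<Rightarrow> bool" where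
  "bgeq BX u \<longleftrightarrow> True"
| "bgeq (BL w x y z) (BL w' x' y' z') \<longleftrightarrow> w' \<le> w \<and> x' \<le> x \<and> y' \<le> y \<and> z' \<le> z"
| "bgeq (BN l r) (BN l' r') \<longleftrightarrow> bgeq l l' \<and> bgeq r r'"
| "bgeq t u \<longleftrightarrow> False"

lemma admits_bgeq: "bgeq t u \<Longrightarrow> admits t ss a b d \<Longrightarrow> admits u ss a b d"
proof (induction t u arbitrary: ss rule: bgeq.induct)
  case (2 w x y z w' x' y' z')
  then show ?case by (cases ss) (auto split: if_splits)
next
  case (3 l r l' r')
  then show ?case by (cases ss) auto
qed auto

lemma cut_bound_mono: "cut_bound p K \<Longrightarrow> bgeq K K' \<Longrightarrow> cut_bound p K'"
  unfolding cut_bound_def using admits_bgeq by blast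

section \<open>Short cycles\<close>

definition adj :: "pole \<Rightarrow> nat \<Rightarrow> nat \<Rightarrow> bool" where
  "adj p u v \<longleftrightarrow> u \<noteq> v \<and> (\<exists>e. u \<in> owners p e \<and> v \<in> owners p e)"

fun near :: "pole \<Rightarrow> nat \<Rightarrow> nat \<Rightarrow> nat \<Rightarrow> bool" where
  "near p 0 u v \<longleftrightarrow> u = v"
| "near p (Suc k) u v \<longleftrightarrow> (\<exists>w. near p k u w \<and> adj p w v)"

definition no_short_cycles :: "pole \<Rightarrow> bool" where
  "no_short_cycles p \<longleftrightarrow>
     (\<forall>u v e f. u \<noteq> v \<longrightarrow> {u, v} \<subseteq> owners p e \<inter> owners p f \<longrightarrow> e = f) \<and>
     (\<forall>u v w. adj p u v \<longrightarrow> adj p v w \<longrightarrow> \<not> adj p u w) \<and>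
     (\<forall>u v w v'. adj p u v \<longrightarrow> adj p v w \<longrightarrow> adj p u v' \<longrightarrow> adj p v' w \<longrightarrow> u \<noteq> w \<longrightarrow> v = v')"

text \<open>Values beyond 3 carry no information: a vertex attached to two strands whose owners are
  at distance d closes a cycle of length d + 2, and d = 3 already gives length 5.
  \<open>near\<close> speaks of walks of exactly \<open>k\<close> steps, so the lengths 0, 1 and 2
  are excluded one by one.\<close>

definition distance_bound :: "pole \<Rightarrow> nat list list \<Rightarrow> bool" where
  "distance_bound p D \<longleftrightarrow> length D = length (str p) \<and>
     (\<forall>i < length (str p). \<forall>j < length (str p). i \<noteq> j \<longrightarrow> (\<forall>k < 3. k < D ! i ! j \<longrightarrow>
        (\<forall>u \<in> owners p (str p ! i). \<forall>v \<in> owners p (str p ! j). \<not> near p k u v)))"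

definition min_list_with :: "nat list \<Rightarrow> nat \<Rightarrow> nat" where
  "min_list_with xs a = foldr min xs a"

text \<open>Two new strands share their owner, hence 0. A walk from the new vertex starts with a
  step to an attached owner, hence \<open>Suc\<close>, capped at 3. A walk between old owners
  through the new vertex spends two steps there, hence \<open>+ 2\<close>. The shift
  \<open>+ t - k\<close> turns a position behind the \<open>k\<close> new strands into the position
  in the old list.\<close>

fun dstep :: "step \<Rightarrow> nat list list \<Rightarrow> nat list list" where
  "dstep (Pull k) D = map (pull k) (pull k D)"
| "dstep (Vertex t) D = (let k = 3 - t in
     map (\<lambda>i. map (\<lambda>j.
       if i < k \<and> j < k then 0
       else if i < k then min_list_with (map (\<lambda>x. Suc (D ! x ! (j + t - k))) [0..<t]) 3
       else if j < k then min_list_with (map (\<lambda>x. Suc (D ! x ! (i + t - k))) [0..<t]) 3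
       else min_list_with
         (concat (map (\<lambda>x. map (\<lambda>y. D ! x ! (i + t - k) + 2 + D ! y ! (j + t - k)) [0..<t]) [0..<t]))
         (D ! (i + t - k) ! (j + t - k)))
     [0..<k + (length D - t)]) [0..<k + (length D - t)])"

text \<open>Cycles can arise only in a \<open>Vertex\<close> step; for \<open>Pull\<close> the
  matrix must be square so that its rows can be permuted.\<close>

fun separated :: "step \<Rightarrow> nat list list \<Rightarrow> bool" where
  "separated (Pull k) D \<longleftrightarrow> list_all (\<lambda>xs. length xs = length D) D"
| "separated (Vertex t) D \<longleftrightarrow>
     list_all (\<lambda>i. list_all (\<lambda>j. i = j \<or> 3 \<le> D ! i ! j) [0..<t]) [0..<t]"

lemma less_min_list_with: "k < min_list_with xs a \<longleftrightarrow> k < a \<and> (\<forall>x\<in>set xs. k < x)"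
  by (induction xs) (auto simp: min_list_with_def)

lemma adj_sym: "adj p u v \<longleftrightarrow> adj p v u"
  by (auto simp: adj_def)

lemma near_2: "near p 2 u v \<longleftrightarrow> (\<exists>w. adj p u w \<and> adj p w v)"
  by (simp add: numeral_2_eq_2)

lemma near_1: "near p 1 u v \<longleftrightarrow> adj p u v"
  by simp

lemma near_sym: "k < 3 \<Longrightarrow> near p k u v \<longleftrightarrow> near p k v u"
  using adj_sym[of p] by (auto simp: nat_less_3 near_2 simp del: near.simps(2)) (auto simp: near_1)

lemma owners_nv: "u \<in> owners p e \<Longrightarrow> u < nv p"
  by (simp add: owners_def)

context
  fixes p :: pole and t :: nat and Nb :: "nat set"
  assumes wf: "wf_pole p" and t: "t \<le> length (str p)"
  defines "Nb \<equiv> {v. \<exists>e \<in> set (take t (str p)). v \<in> owners p e}"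
begin

lemma owners_Vertex_old: "u \<noteq> nv p \<Longrightarrow> u \<in> owners (extend (Vertex t) p) e \<longleftrightarrow> u \<in> owners p e"
  by (auto simp: owners_Vertex[OF wf] simp del: extend.simps)

lemma owners_Vertex_new: "u \<in> owners p e \<Longrightarrow> nv p \<in> owners (extend (Vertex t) p) e \<longleftrightarrow> e \<in> set (take t (str p))"
  using owners_new[OF wf, of e] by (auto simp: owners_Vertex[OF wf] simp del: extend.simps)

lemma adj_Vertex_old: "u \<noteq> nv p \<Longrightarrow> v \<noteq> nv p \<Longrightarrow> adj (extend (Vertex t) p) u v \<longleftrightarrow> adj p u v"
  by (simp add: adj_def owners_Vertex_old del: extend.simps)

lemma adj_Vertex_new: "adj (extend (Vertex t) p) (nv p) v \<longleftrightarrow> v \<in> Nb"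
proof (cases "v = nv p")
  case True
  then show ?thesis by (simp add: adj_def Nb_def del: extend.simps)
next
  case False
  have "adj (extend (Vertex t) p) (nv p) v \<longleftrightarrow> (\<exists>e. v \<in> owners p e \<and> nv p \<in> owners (extend (Vertex t) p) e)"
    using False by (auto simp: adj_def owners_Vertex_old simp del: extend.simps)
  also have "\<dots> \<longleftrightarrow> v \<in> Nb" using owners_Vertex_new by (auto simp: Nb_def simp del: extend.simps)
  finally show ?thesis .
qed

lemma nv_notin_Nb: "nv p \<notin> Nb"
  by (simp add: Nb_def)

text \<open>With at most two steps, a walk between old vertices can visit the new vertex only in the
  middle, so both of its ends are neighbours of the new vertex.\<close>

lemma near_Vertex_old:
  assumes "k < 3" "u \<noteq> nv p" "v \<noteq> nv p" "near (extend (Vertex t) p) k u v"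
  shows "near p k u v \<or> (k = 2 \<and> u \<in> Nb \<and> v \<in> Nb)"
proof -
  consider "k = 0" | "k = 1" | "k = 2" using assms(1) by linarith
  then show ?thesis
  proof cases
    case 3
    then obtain w where w: "adj (extend (Vertex t) p) u w" "adj (extend (Vertex t) p) w v" using assms(4) near_2 by blast
    show ?thesis
    proof (cases "w = nv p")
      case True
      then show ?thesis using w adj_sym[of "extend (Vertex t) p"] adj_Vertex_new 3 by blast
    next
      case False
      then have "adj p u w" "adj p w v" using w assms(2,3) by (simp_all add: adj_Vertex_old del: extend.simps)
      then show ?thesis using 3 near_2 by blast
    qed
  qed (use assms adj_Vertex_old in \<open>simp_all del: extend.simps\<close>)
qed

lemma near_Vertex_new:
  assumes "k < 3" "v \<noteq> nv p" "near (extend (Vertex t) p) k (nv p) v"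
  shows "\<exists>w\<in>Nb. 0 < k \<and> near p (k - 1) w v"
proof -
  consider "k = 0" | "k = 1" | "k = 2" using assms(1) by linarith
  then show ?thesis
  proof cases
    case 2
    then show ?thesis using assms adj_Vertex_new by (auto simp del: extend.simps)
  next
    case 3
    then obtain w where w: "adj (extend (Vertex t) p) (nv p) w" "adj (extend (Vertex t) p) w v" using assms(3) near_2 by blast
    then have "w \<in> Nb" using adj_Vertex_new by blast
    moreover have "w \<noteq> nv p" using calculation nv_notin_Nb by blast
    then have "adj p w v" using w assms(2) adj_Vertex_old by blast
    ultimately show ?thesis using 3 by auto
  qed (use assms in simp)
qed

end

lemma in_take_conv: "t \<le> length xs \<Longrightarrow> e \<in> set (take t xs) \<longleftrightarrow> (\<exists>i<t. e = xs ! i)"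
  by (auto simp: in_set_conv_nth)

text \<open>Parallel edges, a triangle or a 4-cycle through the new vertex would give a walk of
  length 0, 1 or 2 between the owners of two consumed strands.\<close>

lemma no_short_cycles_extend:
  assumes wf: "wf_pole p" and app: "applicable s (length (str p))" and D: "distance_bound p D"
    and sep: "separated s D" and ns: "no_short_cycles p"
  shows "no_short_cycles (extend s p)"
proof (cases s)
  case (Pull k)
  have "adj (extend s p) = adj p" using Pull by (auto simp: adj_def fun_eq_iff simp del: extend.simps)
  moreover have "owners (extend s p) = owners p" using Pull by (auto simp del: extend.simps)
  ultimately show ?thesis using ns unfolding no_short_cycles_def by metis
next
  case (Vertex t)
  have t: "t \<le> length (str p)" using app Vertex by simp
  let ?N = "nv p"
  define q where "q = extend (Vertex t) p"
  define Nb where "Nb = {v. \<exists>e \<in> set (take t (str p)). v \<in> owners p e}"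
  note old = adj_Vertex_old[OF wf t, folded q_def]
  note new = adj_Vertex_new[OF wf t, folded q_def Nb_def]
  note NN = nv_notin_Nb[OF wf t, folded Nb_def]
  have far: "\<not> near p k u v" if "u \<in> owners p e" "v \<in> owners p f" "e \<noteq> f"
      "e \<in> set (take t (str p))" "f \<in> set (take t (str p))" "k < 3" for u v e f k
  proof -
    obtain i j where ij: "i < t" "e = str p ! i" "j < t" "f = str p ! j"
      using \<open>e \<in> _\<close> \<open>f \<in> _\<close> in_take_conv[OF t] by auto
    then have "i \<noteq> j" using that by auto
    have "\<forall>i\<in>{0..<t}. \<forall>j\<in>{0..<t}. i = j \<or> 3 \<le> D ! i ! j"
      using sep Vertex by (simp add: list_all_iff)
    then have "3 \<le> D ! i ! j" using ij(1,3) \<open>i \<noteq> j\<close> by (meson atLeastLessThan_iff le0)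
    then show ?thesis using D ij t \<open>i \<noteq> j\<close> that unfolding distance_bound_def by (metis order_less_le_trans)
  qed
  have far': "\<not> near p k u v" if "u \<in> Nb" "v \<in> Nb" "u \<noteq> v" "k < 3" for u v k
  proof -
    obtain e f where e: "e \<in> set (take t (str p))" "u \<in> owners p e" and f: "f \<in> set (take t (str p))" "v \<in> owners p f"
      using \<open>u \<in> Nb\<close> \<open>v \<in> Nb\<close> by (auto simp: Nb_def)
    have "e \<noteq> f"
    proof
      assume "e = f"
      moreover obtain w where "owners p e = {w}"
        using owner_unique[OF wf] e(1) set_take_subset by (metis subsetD)
      ultimately show False using e f that by auto
    qed
    then show ?thesis using far e f that by blast
  qed
  have par: "e = f" if "u \<noteq> v" "u \<in> owners q e" "v \<in> owners q e" "u \<in> owners q f" "v \<in> owners q f" "v \<noteq> ?N"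
    for u v e f
  proof (cases "u = ?N")
    case True
    have v: "v \<in> owners p e" "v \<in> owners p f" using that owners_Vertex_old[OF wf t, folded q_def] by auto
    then have "e \<in> set (take t (str p))" "f \<in> set (take t (str p))"
      using that True owners_Vertex_new[OF wf t, folded q_def] by blast+
    then show ?thesis using far[OF v(1) v(2), of 0] by auto
  next
    case False
    then show ?thesis using ns that owners_Vertex_old[OF wf t, folded q_def] unfolding no_short_cycles_def by blast
  qed
  have sym: "adj q u v \<longleftrightarrow> adj q v u" for u v by (rule adj_sym)
  have tri0: "\<not> (v \<in> Nb \<and> w \<in> Nb \<and> adj p v w)" for v w
    using far'[of v w 1] by (auto simp: adj_def)
  have tri: "\<not> (adj q u v \<and> adj q v w \<and> adj q u w)" for u v w
  proof
    assume a: "adj q u v \<and> adj q v w \<and> adj q u w"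
    show False
    proof (cases "?N \<in> {u, v, w}")
      case False
      then have "adj p u v" "adj p v w" "adj p u w" using a old by auto
      then show False using ns unfolding no_short_cycles_def by blast
    next
      case True
      then obtain x y where "adj q ?N x" "adj q ?N y" "adj q x y"
        using a sym by blast
      then have "x \<in> Nb" "y \<in> Nb" "adj p x y" using new old NN by metis+
      then show False using tri0 by blast
    qed
  qed
  have C1: False if "adj q ?N v" "adj q v w" "adj q ?N v'" "adj q v' w" "w \<noteq> ?N" "v \<noteq> v'" for v w v'
  proof -
    have v: "v \<in> Nb" "v' \<in> Nb" using that new by auto
    then have "adj p v w" "adj p w v'" using that old NN sym by metis+
    then have "near p 2 v v'" using near_2 by blast
    then show False using far' v that by simp
  qed
  have C: "v = v'" if "adj q u v" "adj q v w" "adj q u v'" "adj q v' w" "u \<noteq> w" for u v w v'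
  proof (rule ccontr)
    assume ne: "v \<noteq> v'"
    \<comment> \<open>By rotation and reflection the new vertex may be taken as the first vertex of
      the 4-cycle, which is \<open>C1\<close>.\<close>
    consider "u = ?N" | "w = ?N" | "v = ?N" | "v' = ?N" | "?N \<notin> {u, v, w, v'}" by blast
    then show False
    proof cases
      case 1 then show False using C1[of v w v'] that ne by metis
    next
      case 2 then show False using C1[of v u v'] that ne sym by metis
    next
      case 3 then show False using C1[of u v' w] that ne sym by metis
    next
      case 4 then show False using C1[of u v w] that ne sym by metis
    next
      case 5
      then have "adj p u v" "adj p v w" "adj p u v'" "adj p v' w" using that old by auto
      then show False using ns ne that unfolding no_short_cycles_def by blast
    qed
  qed
  have "e = f" if "u \<noteq> v" "{u, v} \<subseteq> owners q e \<inter> owners q f" for u v e f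
  proof (cases "v = ?N")
    case True
    then show ?thesis using par[of v u e f] that by auto
  next
    case False
    then show ?thesis using par[of u v e f] that by auto
  qed
  then show ?thesis unfolding Vertex q_def[symmetric] no_short_cycles_def using tri C by blast
qed

lemma distance_bound_extend:
  assumes wf: "wf_pole p" and app: "applicable s (length (str p))" and D: "distance_bound p D"
    and sep: "separated s D"
  shows "distance_bound (extend s p) (dstep s D)"
proof (cases s)
  case (Pull k)
  let ?n = "length (str p)"
  define f where "f i = (if i = 0 then k else if i \<le> k then i - 1 else i)" for i
  have k: "k < ?n" and lD: "length D = ?n" using app D Pull by (auto simp: distance_bound_def)
  have f: "f i < ?n" if "i < ?n" for i using that k by (auto simp: f_def)
  have inj: "f i \<noteq> f j" if "i \<noteq> j" for i j using that by (auto simp: f_def)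
  have rows: "length (D ! i) = ?n" if "i < ?n" for i
    using sep Pull that lD by (auto simp: list_all_length)
  have nD: "dstep s D ! i ! j = D ! f i ! f j" if "i < ?n" "j < ?n" for i j
    using that k lD f rows Pull by (simp add: length_pull nth_pull f_def)
  have "near (extend s p) = near p"
  proof (intro ext)
    fix m u v
    have "adj (extend s p) = adj p" using Pull by (auto simp: adj_def fun_eq_iff simp del: extend.simps)
    then show "near (extend s p) m u v = near p m u v" by (induction m arbitrary: v) simp_all
  qed
  moreover have "str (extend s p) ! i = str p ! f i" if "i < ?n" for i
    using that k Pull by (simp add: nth_pull f_def)
  moreover have "owners (extend s p) = owners p" using Pull by (auto simp del: extend.simps)
  moreover have "length (str (extend s p)) = ?n" "length (dstep s D) = ?n"
    using k lD Pull by (simp_all add: length_pull)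
  moreover have "\<not> near p m u v"
    if "i < ?n" "j < ?n" "i \<noteq> j" "m < 3" "m < D ! f i ! f j"
      "u \<in> owners p (str p ! f i)" "v \<in> owners p (str p ! f j)" for i j m u v
    using D that f[of i] f[of j] inj[of i j] unfolding distance_bound_def by blast
  ultimately show ?thesis unfolding distance_bound_def by (simp add: nD)
next
  case (Vertex t)
  have t: "t \<le> 3" "t \<le> length (str p)" using app Vertex by auto
  let ?N = "nv p"
  define q where "q = extend (Vertex t) p"
  define Nb where "Nb = {v. \<exists>e \<in> set (take t (str p)). v \<in> owners p e}"
  define k where "k = 3 - t"
  define n where "n = length (str p)"
  have lD: "length D = n" using D by (simp add: distance_bound_def n_def)
  let ?m = "k + (n - t)"
  have lq: "length (str q) = ?m" by (simp add: q_def k_def n_def)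
  have so: "str q ! i = str p ! (i + t - k)" "i + t - k < n" "t \<le> i + t - k" if "k \<le> i" "i < ?m" for i
    using that t by (auto simp: q_def k_def n_def nth_append ac_simps)
  have sn: "owners q (str q ! i) = {?N}" if "i < k" for i
  proof -
    have "str q ! i = ne p + i" using that by (simp add: q_def k_def nth_append)
    moreover have "ne p + i < ne p + (3 - t)" using that by (simp add: k_def)
    ultimately show ?thesis using owners_new[OF wf, of "ne p + i"] t(1) that
      by (auto simp add: q_def k_def owners_Vertex[OF wf] simp del: extend.simps)
  qed
  have so': "owners q (str q ! i) = owners p (str p ! (i + t - k))" if "k \<le> i" "i < ?m" for i
  proof -
    have "str p ! (i + t - k) \<notin> set (take t (str p))"
    proof
      assume "str p ! (i + t - k) \<in> set (take t (str p))"
      then obtain j where "j < t" "str p ! (i + t - k) = str p ! j" using in_take_conv[OF t(2)] by blast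
      moreover have "distinct (str p)" using wf by (simp add: wf_pole_def)
      ultimately show False using so[OF that] t by (auto simp: nth_eq_iff_index_eq n_def)
    qed
    moreover have "str p ! (i + t - k) < ne p"
      using so(2)[OF that] wf unfolding wf_pole_def n_def by (meson lessThan_iff nth_mem subsetD)
    ultimately show ?thesis using so(1)[OF that]
      by (simp add: q_def owners_Vertex[OF wf] del: extend.simps)
  qed
  have Db: "\<not> near p d u v" if "i < n" "j < n" "i \<noteq> j" "d < 3" "d < D ! i ! j"
      "u \<in> owners p (str p ! i)" "v \<in> owners p (str p ! j)" for i j d u v
    using D that unfolding distance_bound_def n_def by blast
  have Nbx: "\<exists>x<t. u \<in> owners p (str p ! x)" if "u \<in> Nb" for u
    using that in_take_conv[OF t(2)] by (auto simp: Nb_def)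
  note nold = near_Vertex_old[OF wf t(2), folded q_def Nb_def]
  note nnew = near_Vertex_new[OF wf t(2), folded q_def Nb_def]
  have Nv: "v \<noteq> ?N" if "v \<in> owners p e" for v e using that owners_nv by fastforce
  have newold: "\<not> near q d ?N v" if j: "k \<le> j" "j < ?m" and v: "v \<in> owners q (str q ! j)" and d: "d < 3"
    "d < min_list_with (map (\<lambda>x. Suc (D ! x ! (j + t - k))) [0..<t]) 3" for j d v
  proof
    assume a: "near q d ?N v"
    have v': "v \<in> owners p (str p ! (j + t - k))" using v so' j by simp
    obtain w where w: "w \<in> Nb" "0 < d" "near p (d - 1) w v" using nnew[OF d(1) Nv[OF v'] a] by blast
    obtain x where x: "x < t" "w \<in> owners p (str p ! x)" using Nbx w by blast
    have "d < Suc (D ! x ! (j + t - k))" using d(2) x by (auto simp: less_min_list_with)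
    moreover have "x < n" "x \<noteq> j + t - k" using x so[OF j] by auto
    ultimately show False using Db[of x "j + t - k" "d - 1" w v] w x so(2)[OF j] v' d by auto
  qed
  have "\<not> near q d u v"
    if i: "i < ?m" and j: "j < ?m" and ij: "i \<noteq> j" and d: "d < 3" "d < dstep s D ! i ! j"
      and u: "u \<in> owners q (str q ! i)" and v: "v \<in> owners q (str q ! j)" for i j d u v
  proof -
    have val: "dstep s D ! i ! j = (if i < k \<and> j < k then 0
       else if i < k then min_list_with (map (\<lambda>x. Suc (D ! x ! (j + t - k))) [0..<t]) 3
       else if j < k then min_list_with (map (\<lambda>x. Suc (D ! x ! (i + t - k))) [0..<t]) 3
       else min_list_with
         (concat (map (\<lambda>x. map (\<lambda>y. D ! x ! (i + t - k) + 2 + D ! y ! (j + t - k)) [0..<t]) [0..<t]))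
         (D ! (i + t - k) ! (j + t - k)))"
      using i j lD by (simp add: Vertex k_def[symmetric] Let_def del: upt_Suc)
    consider "i < k" "j < k" | "i < k" "k \<le> j" | "k \<le> i" "j < k" | "k \<le> i" "k \<le> j" by linarith
    then show ?thesis
    proof cases
      case 1 then show ?thesis using d val by simp
    next
      case 2
      then show ?thesis using newold[of j v d] j v d val u sn[of i] by simp
    next
      case 3
      then show ?thesis using newold[of i u d] i u d val v sn[of j] near_sym[OF d(1), of q u v] by simp
    next
      case 4
      show ?thesis
      proof
        assume a: "near q d u v"
        have uv: "u \<in> owners p (str p ! (i + t - k))" "v \<in> owners p (str p ! (j + t - k))"
          using u v so' 4 i j by simp_all
        have ne: "i + t - k \<noteq> j + t - k" using ij 4 by simp
        have lt: "i + t - k < n" "j + t - k < n" using so 4 i j by blast+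
        have dD: "d < D ! (i + t - k) ! (j + t - k)"
          and dxy: "\<And>x y. x < t \<Longrightarrow> y < t \<Longrightarrow> d < D ! x ! (i + t - k) + 2 + D ! y ! (j + t - k)"
          using d val 4 by (auto simp: less_min_list_with)
        from nold[OF d(1) Nv[OF uv(1)] Nv[OF uv(2)] a]
        show False
        proof
          assume "near p d u v"
          then show False using Db[OF lt ne d(1) dD uv] by blast
        next
          assume b: "d = 2 \<and> u \<in> Nb \<and> v \<in> Nb"
          then obtain x y where x: "x < t" "u \<in> owners p (str p ! x)" and y: "y < t" "v \<in> owners p (str p ! y)"
            using Nbx by blast
          have xn: "x < n" "x \<noteq> i + t - k" "y < n" "y \<noteq> j + t - k"
            using x y so[OF 4(1) i] so[OF 4(2) j] by auto
          \<comment> \<open>Yet \<open>u\<close> owns both strands of the first entry and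
            \<open>v\<close> both strands of the second, so neither bound can be positive.\<close>
          have "D ! x ! (i + t - k) > 0 \<or> D ! y ! (j + t - k) > 0"
            using dxy[OF x(1) y(1)] b by auto
          then show False
            using Db[of x "i + t - k" 0 u u] Db[of y "j + t - k" 0 v v] xn lt x y uv by auto
        qed
      qed
    qed
  qed
  moreover have "length (dstep s D) = ?m" by (simp add: Vertex lD k_def Let_def)
  ultimately show ?thesis unfolding Vertex q_def[symmetric] distance_bound_def lq
    by (simp del: dstep.simps)
qed

definition dgeq :: "nat list list \<Rightarrow> nat list list \<Rightarrow> bool" where
  "dgeq D D' \<longleftrightarrow> list_all2 (list_all2 (\<lambda>x y. y \<le> x)) D D' \<and> list_all (\<lambda>xs. length xs = length D) D"

lemma distance_bound_mono: "distance_bound p D \<Longrightarrow> dgeq D D' \<Longrightarrow> distance_bound p D'"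
proof -
  assume D: "distance_bound p D" and g: "dgeq D D'"
  have l: "length D' = length D" using g list_all2_lengthD by (fastforce simp: dgeq_def)
  have le: "D' ! i ! j \<le> D ! i ! j" if "i < length D" "j < length D" for i j
    using g that by (auto simp: dgeq_def list_all2_conv_all_nth list_all_length)
  have lD: "length D = length (str p)" using D by (simp add: distance_bound_def)
  have lt: "k < D ! i ! j" if "i < length (str p)" "j < length (str p)" "k < D' ! i ! j" for i j k
    using that le[of i j] lD by simp
  show ?thesis unfolding distance_bound_def
  proof (intro conjI allI impI ballI)
    show "length D' = length (str p)" using l lD by simp
  next
    fix i j k u v
    assume a: "i < length (str p)" "j < length (str p)" "i \<noteq> j" "k < 3" "k < D' ! i ! j"
      "u \<in> owners p (str p ! i)" "v \<in> owners p (str p ! j)"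
    then show "\<not> near p k u v" using D lt[OF a(1,2,5)] unfolding distance_bound_def by blast
  qed
qed

section \<open>The combined invariant and the construction of the poles\<close>

definition good :: "pole \<Rightarrow> nat \<Rightarrow> ctree \<Rightarrow> btree \<Rightarrow> nat list list \<Rightarrow> bool" where
  "good p n T K D \<longleftrightarrow> wf_pole p \<and> counts p n T \<and> cut_bound p K \<and> distance_bound p D \<and> no_short_cycles p"

text \<open>The length of \<open>D\<close> stands for the number of strands, so the check does not
  mention the pole and can be evaluated.\<close>

fun feasible :: "step list \<Rightarrow> nat list list \<Rightarrow> bool" where
  "feasible [] D \<longleftrightarrow> True"
| "feasible (s # ss) D \<longleftrightarrow> applicable s (length D) \<and> separated s D \<and> feasible ss (dstep s D)"

lemma good_fold:
  "good p n T K D \<Longrightarrow> feasible ss D \<Longrightarrow>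
   good (fold extend ss p) n (fold cstep ss T) (fold bstep ss K) (fold dstep ss D)"
proof (induction ss arbitrary: p T K D)
  case (Cons s ss)
  have "length D = length (str p)" using Cons.prems by (simp add: good_def distance_bound_def)
  then have "good (extend s p) n (cstep s T) (bstep s K) (dstep s D)"
    using Cons.prems wf_pole_extend[of p s] counts_extend[of p s] cut_bound_extend[of p s]
      distance_bound_extend[of p s] no_short_cycles_extend[of p s D]
    by (simp add: good_def del: extend.simps cstep.simps bstep.simps dstep.simps)
  then show ?case using Cons by (simp del: extend.simps cstep.simps bstep.simps dstep.simps)
qed simp

definition empty_pole :: pole where
  "empty_pole = \<lparr>nv = 0, ne = 0, inc = (\<lambda>_. []), str = []\<rparr>"

text \<open>The entries 9 are arbitrary, since the empty pole has no edges.\<close>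

lemma good_empty_pole: "good empty_pole 1 (CL 1) (BL 0 9 9 9) []"
proof -
  have o: "owners empty_pole e = {}" for e by (simp add: owners_def empty_pole_def)
  have "colourings empty_pole [] = {\<lambda>_. undefined}"
    by (auto simp: colourings_def empty_pole_def PiE_def extensional_def)
  then show ?thesis
    unfolding good_def counts_def cut_bound_def distance_bound_def no_short_cycles_def wf_pole_def
    by (auto simp: o adj_def inner_edge_def cut_def) (auto simp: empty_pole_def cut_def)
qed

text \<open>A path of four vertices is closed by a fifth; the last two pulls put the strands into
  pentagram order.\<close>

definition pentagon_steps :: "step list" where
  "pentagon_steps = [Vertex 0, Vertex 1, Vertex 1, Vertex 1, Pull 4, Vertex 2, Pull 3, Pull 2]"

text \<open>Consecutive vertices of the new pentagon take consecutive strands of the list.\<close>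

definition closing_steps :: "step list" where
  "closing_steps = [Vertex 1, Pull 2, Vertex 2, Pull 2, Vertex 2, Pull 2, Vertex 2, Vertex 3]"

text \<open>Each of the four blocks has as many \<open>Vertex 1\<close> as \<open>Vertex 2\<close>
  steps and so leads from five strands to five; the numbers of vertices are 10, 10, 12 and 14. The
  vertices are ordered so that never more than six strands are open, whence a table of colourings
  has at most 3^6 leaves. The final pulls restore the strand order of
  \<open>pentagon_counts\<close>.\<close>

definition double_steps :: "step list" where
  "double_steps =
     [Pull 1, Vertex 1, Pull 2, Pull 2, Vertex 2, Pull 2, Pull 2, Vertex 2, Vertex 1, Pull 2,
     Vertex 2, Pull 2, Vertex 1, Pull 3, Vertex 2, Pull 3, Vertex 1, Pull 1, Vertex 1, Pull 4,
     Pull 2, Vertex 2, Pull 4, Pull 2]"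

definition triple_steps :: "step list" where
  "triple_steps =
     [Vertex 1, Pull 2, Pull 2, Vertex 2, Pull 3, Vertex 1, Pull 3, Pull 2, Vertex 2, Pull 2,
     Vertex 1, Pull 4, Pull 2, Vertex 2, Pull 3, Pull 2, Vertex 2, Vertex 1, Vertex 1, Pull 4,
     Vertex 2, Pull 3, Pull 2]"

definition quintuple_steps :: "step list" where
  "quintuple_steps =
     [Pull 1, Vertex 1, Pull 2, Pull 2, Vertex 2, Pull 1, Vertex 1, Pull 3, Vertex 2, Vertex 1,
     Pull 4, Vertex 2, Pull 4, Vertex 1, Pull 2, Vertex 2, Pull 4, Vertex 2, Pull 3, Vertex 1,
     Pull 3, Vertex 1, Pull 3, Vertex 2, Pull 4, Pull 1]"

definition septuple_steps :: "step list" where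
  "septuple_steps =
     [Vertex 1, Pull 2, Vertex 2, Vertex 1, Pull 3, Pull 2, Vertex 2, Pull 3, Vertex 1, Pull 2,
     Vertex 2, Pull 1, Vertex 1, Pull 5, Pull 2, Vertex 2, Pull 1, Vertex 1, Pull 5, Pull 2,
     Vertex 2, Pull 2, Vertex 2, Pull 1, Vertex 1, Pull 1, Vertex 1, Pull 5, Vertex 2, Pull 3,
     Pull 2]"

text \<open>There are 30 nonzero entries, all equal to 1: five nonneighbouring pairs of positions
  times six assignments of the colours. They match the 30 = 2^5 - 2 proper 3-edge-colourings of a
  5-cycle.\<close>

definition pentagon_counts :: ctree where
  "pentagon_counts = fold cstep pentagon_steps (CL 1)"

text \<open>The second argument counts the strands that are attached to the vertex set \<open>S\<close>.\<close>

fun cut_table :: "nat \<Rightarrow> nat \<Rightarrow> btree" where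
  "cut_table 0 x = BL ([0, 2, 2, 2, 2, 0] ! x) ([4, 3, 2, 2, 2, 0] ! x) ([0, 2, 2, 2, 3, 4] ! x) ([4, 3, 2, 2, 3, 4] ! x)"
| "cut_table (Suc k) x = BN (cut_table k x) (cut_table k (Suc x))"

definition pentagon_distances :: "nat list list" where
  "pentagon_distances =
     [[0, 2, 1, 1, 2], [2, 0, 2, 1, 1], [1, 2, 0, 2, 1], [1, 1, 2, 0, 2], [2, 1, 1, 2, 0]]"


text \<open>The last list in \<open>cut_table\<close> is 4 - min(x, 5 - x): together with the x or 5
  - x strands that are cut when the rest of the graph lies on one side, it amounts to four edges.
  The other lists are lower where a side may be empty or a single vertex within the pole. Passing to
  the complement exchanges x with 5 - x and the two middle lists.\<close>

lemma pentagon_pole: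
  "good (fold extend pentagon_steps empty_pole) 1 pentagon_counts (cut_table 5 0) pentagon_distances"
proof -
  have "feasible pentagon_steps []" by code_simp
  moreover have "bgeq (fold bstep pentagon_steps (BL 0 9 9 9)) (cut_table 5 0)" by code_simp
  moreover have "dgeq (fold dstep pentagon_steps []) pentagon_distances" by code_simp
  ultimately show ?thesis
    using good_fold[OF good_empty_pole, of pentagon_steps] cut_bound_mono distance_bound_mono
    unfolding good_def pentagon_counts_def by blast
qed

text \<open>A block reproduces the three tables up to the factor \<open>m\<close>, so the premises
  on \<open>ss\<close> are closed computations without \<open>p\<close>, and the conclusion has the
  form of the first premise.\<close>

lemma multiply_pole:
  assumes "good p n pentagon_counts (cut_table 5 0) pentagon_distances"
    and "feasible ss pentagon_distances"
    and "bgeq (fold bstep ss (cut_table 5 0)) (cut_table 5 0)"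
    and "dgeq (fold dstep ss pentagon_distances) pentagon_distances"
    and "fold cstep ss pentagon_counts = cscale m pentagon_counts"
  shows "good (fold extend ss p) (n * m) pentagon_counts (cut_table 5 0) pentagon_distances"
proof -
  have g: "good (fold extend ss p) n (cscale m pentagon_counts) (fold bstep ss (cut_table 5 0))
      (fold dstep ss pentagon_distances)"
    using good_fold[OF assms(1,2)] assms(5) by simp
  have "length (str p) = length pentagon_distances"
    "length (str (fold extend ss p)) = length (fold dstep ss pentagon_distances)"
    using assms(1) g by (simp_all add: good_def distance_bound_def)
  moreover have "length (fold dstep ss pentagon_distances) = length pentagon_distances"
    using assms(4) unfolding dgeq_def by (metis list_all2_lengthD)
  ultimately have "counts (fold extend ss p) (n * m) pentagon_counts"
    using g assms(1) by (simp add: good_def counts_def clookup_cscale mult.assoc)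
  then show ?thesis using g assms(3,4) cut_bound_mono distance_bound_mono unfolding good_def by blast
qed

lemma double_pole:
  "good p n pentagon_counts (cut_table 5 0) pentagon_distances \<Longrightarrow>
   good (fold extend double_steps p) (n * 2) pentagon_counts (cut_table 5 0) pentagon_distances"
  by (erule multiply_pole; code_simp)

lemma triple_pole:
  "good p n pentagon_counts (cut_table 5 0) pentagon_distances \<Longrightarrow>
   good (fold extend triple_steps p) (n * 3) pentagon_counts (cut_table 5 0) pentagon_distances"
  by (erule multiply_pole; code_simp)

lemma quintuple_pole:
  "good p n pentagon_counts (cut_table 5 0) pentagon_distances \<Longrightarrow>
   good (fold extend quintuple_steps p) (n * 5) pentagon_counts (cut_table 5 0) pentagon_distances"
  by (erule multiply_pole; code_simp)

lemma septuple_pole: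
  "good p n pentagon_counts (cut_table 5 0) pentagon_distances \<Longrightarrow>
   good (fold extend septuple_steps p) (n * 7) pentagon_counts (cut_table 5 0) pentagon_distances"
  by (erule multiply_pole; code_simp)

lemma iterated_pole:
  assumes step: "\<And>p n. P p n \<Longrightarrow> P (f p) (n * (a :: nat))" and "P p n"
  shows "\<exists>q. P q (n * a ^ i)"
proof (induction i)
  case 0
  then show ?case using assms(2) by auto
next
  case (Suc i)
  then show ?case using step by (metis mult.assoc power_Suc2)
qed

lemma smooth_pole:
  "\<exists>p. good p (2 ^ i * 3 ^ j * 5 ^ k * 7 ^ l) pentagon_counts (cut_table 5 0) pentagon_distances"
proof -
  let ?P = "\<lambda>p n. good p n pentagon_counts (cut_table 5 0) pentagon_distances"
  obtain p1 where "?P p1 (1 * 2 ^ i)"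
    using iterated_pole[where P = ?P and f = "fold extend double_steps" and a = 2, OF double_pole pentagon_pole] by blast
  then obtain p2 where "?P p2 (1 * 2 ^ i * 3 ^ j)"
    using iterated_pole[where P = ?P and f = "fold extend triple_steps" and a = 3, OF triple_pole] by blast
  then obtain p3 where "?P p3 (1 * 2 ^ i * 3 ^ j * 5 ^ k)"
    using iterated_pole[where P = ?P and f = "fold extend quintuple_steps" and a = 5, OF quintuple_pole] by blast
  then obtain p4 where "?P p4 (1 * 2 ^ i * 3 ^ j * 5 ^ k * 7 ^ l)"
    using iterated_pole[where P = ?P and f = "fold extend septuple_steps" and a = 7, OF septuple_pole] by blast
  then show ?thesis by auto
qed

text \<open>\<open>CZ\<close> says that the closed graph has no 3-edge-colouring, and
  \<open>BL 0 0 0 4\<close> that a set with fewer than four cut edges has a side without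
  edges.\<close>

lemma closed_pole:
  assumes "good p n pentagon_counts (cut_table 5 0) pentagon_distances"
  shows "good (fold extend closing_steps p) n CZ (BL 0 0 0 4) []"
proof -
  have "feasible closing_steps pentagon_distances" by code_simp
  moreover have "bgeq (fold bstep closing_steps (cut_table 5 0)) (BL 0 0 0 4)" by code_simp
  moreover have "dgeq (fold dstep closing_steps pentagon_distances) []" by code_simp
  moreover have "fold cstep closing_steps pentagon_counts = CZ" by code_simp
  ultimately show ?thesis
    using good_fold[OF assms, of closing_steps] cut_bound_mono distance_bound_mono
    unfolding good_def by (metis (no_types, lifting))
qed

section \<open>Edge-disjoint paths\<close>

definition arcs :: "'v list \<Rightarrow> ('v \<times> 'v) set" where
  "arcs xs = set (zip xs (tl xs))"

lemma arcs_simps [simp]: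
  "arcs [] = {}" "arcs [x] = {}" "arcs (x # y # zs) = insert (x, y) (arcs (y # zs))"
  by (simp_all add: arcs_def)

lemma arcs_subset: "(u, v) \<in> arcs xs \<Longrightarrow> u \<in> set xs \<and> v \<in> set xs"
  by (induction xs rule: induct_list012) auto

lemma arcs_append_subset: "arcs ys \<subseteq> arcs (xs @ ys)"
proof (induction xs)
  case (Cons x xs)
  then show ?case by (cases "xs @ ys") auto
qed simp

lemma arcs_antisym: "distinct xs \<Longrightarrow> (u, v) \<in> arcs xs \<Longrightarrow> (v, u) \<notin> arcs xs"
  by (induction xs rule: induct_list012) (auto dest: arcs_subset)

lemma rtranclp_simple_path:
  assumes "R\<^sup>*\<^sup>* a b"
  shows "\<exists>xs. xs \<noteq> [] \<and> distinct xs \<and> hd xs = a \<and> last xs = b \<and> (\<forall>(u, v) \<in> arcs xs. R u v)"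
  using assms
proof (induction rule: converse_rtranclp_induct)
  case base
  show ?case by (rule exI[of _ "[b]"]) simp
next
  case (step y z)
  then obtain xs where xs: "xs \<noteq> []" "distinct xs" "hd xs = z" "last xs = b" "\<forall>(u, v) \<in> arcs xs. R u v"
    by blast
  show ?case
  proof (cases "y \<in> set xs")
    \<comment> \<open>If \<open>y\<close> already lies on the path, the part before it is cut
      off.\<close>
    case True
    then obtain us vs where s: "xs = us @ y # vs" by (meson split_list)
    then show ?thesis using xs arcs_append_subset[of "y # vs" us]
      by (intro exI[of _ "y # vs"]) auto
  next
    case False
    obtain ws where "xs = z # ws" using xs by (cases xs) auto
    then show ?thesis using xs False step.hyps by (intro exI[of _ "y # xs"]) auto
  qed
qed

text \<open>Flows on undirected edges are antisymmetric functions of ordered pairs, so that a path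
  running against existing flow cancels it.\<close>

definition path_flow :: "'v list \<Rightarrow> 'v \<Rightarrow> 'v \<Rightarrow> int" where
  "path_flow xs u v = of_bool ((u, v) \<in> arcs xs) - of_bool ((v, u) \<in> arcs xs)"

lemma path_flow_Cons:
  assumes "distinct (x # y # zs)"
  shows "path_flow (x # y # zs) u v =
    path_flow (y # zs) u v + of_bool (u = x \<and> v = y) - of_bool (u = y \<and> v = x)"
proof -
  have "(x, y) \<notin> arcs (y # zs)" "(y, x) \<notin> arcs (y # zs)" "x \<noteq> y"
    using assms arcs_subset[of x y "y # zs"] arcs_subset[of y x "y # zs"] by auto
  then show ?thesis by (auto simp: path_flow_def)
qed

lemma path_flow_excess:
  assumes "finite V" "distinct xs" "xs \<noteq> []" "set xs \<subseteq> V"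
  shows "(\<Sum>w\<in>V. path_flow xs v w) = of_bool (v = hd xs) - of_bool (v = last xs)"
  using assms(2-)
proof (induction xs rule: induct_list012)
  case (2 x)
  then show ?case by (simp add: path_flow_def)
next
  case (3 x y zs)
  have "(\<Sum>w\<in>V. of_bool (v = x \<and> w = y) :: int) = of_bool (v = x)"
    "(\<Sum>w\<in>V. of_bool (v = y \<and> w = x) :: int) = of_bool (v = y)"
    using 3(5) assms(1) by (cases "v = x"; cases "v = y"; simp add: of_bool_def)+
  then show ?case using 3 unfolding path_flow_Cons[OF 3(3)] by (simp add: sum.distrib sum_subtractf)
qed simp

text \<open>Sets of terminals make it unnecessary to contract the two cycles to a source and a
  sink.\<close>

locale terminals =
  fixes V :: "'v set" and E :: "'v \<Rightarrow> 'v \<Rightarrow> bool" and A B :: "'v set"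
  assumes fin: "finite V" and sym: "E u v \<Longrightarrow> E v u" and E_V: "E u v \<Longrightarrow> u \<in> V"
    and AV: "A \<subseteq> V" and BV: "B \<subseteq> V" and AB: "A \<inter> B = {}"
begin

definition flow :: "('v \<Rightarrow> 'v \<Rightarrow> int) \<Rightarrow> bool" where
  "flow f \<longleftrightarrow> (\<forall>u v. f u v = - f v u \<and> f u v \<le> 1 \<and> (f u v \<noteq> 0 \<longrightarrow> E u v)) \<and>
     (\<forall>v \<in> V - A - B. (\<Sum>w\<in>V. f v w) = 0)"

definition val :: "('v \<Rightarrow> 'v \<Rightarrow> int) \<Rightarrow> int" where
  "val f = (\<Sum>a\<in>A. \<Sum>w\<in>V. f a w)"

text \<open>Vertices of \<open>S\<close> outside \<open>A\<close> have no excess, and arcs within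
  \<open>S\<close> cancel in pairs by antisymmetry.\<close>

lemma val_cut:
  assumes f: "flow f" and S: "A \<subseteq> S" "S \<subseteq> V" "S \<inter> B = {}"
  shows "val f = (\<Sum>u\<in>S. \<Sum>w\<in>V - S. f u w)"
proof -
  have anti: "f u v = - f v u" for u v using f unfolding flow_def by blast
  have cons: "(\<Sum>w\<in>V. f v w) = 0" if "v \<in> V - A - B" for v using f that unfolding flow_def by blast
  have fS: "finite S" using S fin finite_subset by blast
  have "val f = (\<Sum>u\<in>S. \<Sum>w\<in>V. f u w)"
    unfolding val_def using S fS cons by (intro sum.mono_neutral_left) auto
  also have "\<dots> = (\<Sum>u\<in>S. (\<Sum>w\<in>V - S. f u w) + (\<Sum>w\<in>S. f u w))"
    using S fin by (simp add: sum.subset_diff[of S V])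
  also have "\<dots> = (\<Sum>u\<in>S. \<Sum>w\<in>V - S. f u w) + (\<Sum>u\<in>S. \<Sum>w\<in>S. f u w)"
    by (rule sum.distrib)
  also have "(\<Sum>u\<in>S. \<Sum>w\<in>S. f u w) = 0"
  proof -
    have "(\<Sum>u\<in>S. \<Sum>w\<in>S. f u w) = (\<Sum>w\<in>S. \<Sum>u\<in>S. f u w)" by (rule sum.swap)
    also have "\<dots> = (\<Sum>w\<in>S. \<Sum>u\<in>S. - f w u)" by (intro sum.cong refl anti)
    also have "\<dots> = - (\<Sum>w\<in>S. \<Sum>u\<in>S. f w u)" by (simp add: sum_negf)
    finally show ?thesis by simp
  qed
  finally show ?thesis by simp
qed

text \<open>This serves twice: for residual arcs, where a closed set would be a saturated cut, and
  for arcs carrying flow, where a closed set would force a nonpositive value.\<close>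

lemma path_or_closed:
  assumes R: "\<And>u v. R u v \<Longrightarrow> E u v"
  shows "(\<exists>xs. xs \<noteq> [] \<and> distinct xs \<and> set xs \<subseteq> V \<and> hd xs \<in> A \<and> last xs \<in> B \<and> (\<forall>(u, v) \<in> arcs xs. R u v)) \<or>
    (\<exists>S. A \<subseteq> S \<and> S \<subseteq> V \<and> S \<inter> B = {} \<and> (\<forall>u\<in>S. \<forall>v. R u v \<longrightarrow> v \<in> S))"
proof (cases "\<exists>a\<in>A. \<exists>b\<in>B. R\<^sup>*\<^sup>* a b")
  case True
  then obtain a b where ab: "a \<in> A" "b \<in> B" "R\<^sup>*\<^sup>* a b" by blast
  obtain xs where xs: "xs \<noteq> []" "distinct xs" "hd xs = a" "last xs = b" "\<forall>(u, v) \<in> arcs xs. R u v"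
    using rtranclp_simple_path[OF ab(3)] by blast
  have "set ys \<subseteq> V" if "ys \<noteq> []" "last ys \<in> V" "\<forall>(u, v) \<in> arcs ys. R u v" for ys
    using that
  proof (induction ys rule: induct_list012)
    case (3 x y zs)
    then show ?case using R E_V by auto
  qed auto
  then show ?thesis using xs ab BV by blast
next
  case False
  let ?S = "{v. \<exists>a\<in>A. R\<^sup>*\<^sup>* a v}"
  have "v \<in> V" if "a \<in> A" "R\<^sup>*\<^sup>* a v" for a v
    using that(2,1) R E_V sym AV by (induction rule: rtranclp_induct) blast+
  then have "A \<subseteq> ?S" "?S \<subseteq> V" "?S \<inter> B = {}" "\<forall>u\<in>?S. \<forall>v. R u v \<longrightarrow> v \<in> ?S"
    using False by (auto intro: rtranclp.rtrancl_into_rtrancl)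
  then show ?thesis by blast
qed

lemma val_path_flow:
  assumes "distinct xs" "xs \<noteq> []" "set xs \<subseteq> V" "hd xs \<in> A" "last xs \<in> B"
  shows "(\<Sum>a\<in>A. \<Sum>w\<in>V. path_flow xs a w) = 1"
    and "v \<in> V - A - B \<Longrightarrow> (\<Sum>w\<in>V. path_flow xs v w) = 0"
proof -
  have ex: "(\<Sum>w\<in>V. path_flow xs a w) = of_bool (a = hd xs) - of_bool (a = last xs)" for a
    by (rule path_flow_excess[OF fin assms(1-3)])
  have "(\<Sum>a\<in>A. \<Sum>w\<in>V. path_flow xs a w) = (\<Sum>a\<in>A. of_bool (a = hd xs))"
    unfolding ex using assms(5) AB by (intro sum.cong) auto
  also have "\<dots> = 1" using assms(4) AV fin finite_subset[of A V] by (simp add: of_bool_def)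
  finally show "(\<Sum>a\<in>A. \<Sum>w\<in>V. path_flow xs a w) = 1" .
  show "(\<Sum>w\<in>V. path_flow xs v w) = 0" if "v \<in> V - A - B"
    unfolding ex using that assms(4,5) by auto
qed

text \<open>An arc with \<open>f u v\<close> at most 0 has residual capacity. If residual arcs do
  not lead from \<open>A\<close> to \<open>B\<close>, all edges leaving the reached set are
  saturated, so the value is at least \<open>m\<close>.\<close>

lemma augment:
  assumes f: "flow f" and v: "val f < int m"
    and cut: "\<And>S. A \<subseteq> S \<Longrightarrow> S \<subseteq> V \<Longrightarrow> S \<inter> B = {} \<Longrightarrow> m \<le> card {(u, w). E u w \<and> u \<in> S \<and> w \<notin> S}"
  shows "\<exists>g. flow g \<and> val g = val f + 1"
proof -
  let ?R = "\<lambda>u v. E u v \<and> f u v \<le> 0"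
  have anti: "f u v = - f v u" and le: "f u v \<le> 1" and fE: "f u v \<noteq> 0 \<Longrightarrow> E u v" for u v
    using f unfolding flow_def by blast+
  have cons: "(\<Sum>w\<in>V. f v w) = 0" if "v \<in> V - A - B" for v using f that unfolding flow_def by blast
  have no: False if S: "A \<subseteq> S" "S \<subseteq> V" "S \<inter> B = {}" and cl: "\<forall>u\<in>S. \<forall>v. ?R u v \<longrightarrow> v \<in> S" for S
  proof -
    have fS: "finite S" using S fin finite_subset by blast
    have fval: "f u w = of_bool (E u w)" if "u \<in> S" "w \<in> V - S" for u w
    proof (cases "E u w")
      case True
      then have "\<not> f u w \<le> 0" using cl that by blast
      then show ?thesis using True le[of u w] by simp
    next
      case False
      then show ?thesis using fE by fastforce
    qed
    have "val f = (\<Sum>u\<in>S. \<Sum>w\<in>V - S. of_bool (E u w))"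
      unfolding val_cut[OF f S] using fval by (intro sum.cong refl) auto
    also have "\<dots> = (\<Sum>(u, w)\<in>S \<times> (V - S). of_bool (E u w))"
      by (rule sum.cartesian_product)
    also have "\<dots> = int (card (S \<times> (V - S) \<inter> {x. E (fst x) (snd x)}))"
      using fS fin by (simp add: case_prod_beta)
    also have "S \<times> (V - S) \<inter> {x. E (fst x) (snd x)} = {(u, w). E u w \<and> u \<in> S \<and> w \<notin> S}"
      using E_V sym by auto
    finally show False using cut[OF S] v by simp
  qed
  obtain xs where xs: "xs \<noteq> []" "distinct xs" "set xs \<subseteq> V" "hd xs \<in> A" "last xs \<in> B"
    "\<forall>(u, v) \<in> arcs xs. ?R u v"
    using path_or_closed[of ?R] no by blast
  define g where "g u v = f u v + path_flow xs u v" for u v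
  have "g u v = - g v u \<and> g u v \<le> 1 \<and> (g u v \<noteq> 0 \<longrightarrow> E u v)" for u v
  proof -
    have "(v, u) \<in> arcs xs \<longrightarrow> E v u" "(u, v) \<in> arcs xs \<longrightarrow> E u v \<and> f u v \<le> 0" using xs(6) by auto
    then show ?thesis using anti[of u v] le[of u v] fE[of u v] sym[of v u] arcs_antisym[OF xs(2), of u v]
      by (auto simp: g_def path_flow_def)
  qed
  moreover have "(\<Sum>w\<in>V. g v w) = 0" if "v \<in> V - A - B" for v
    using cons[OF that] val_path_flow(2)[OF xs(2,1,3-5) that] by (simp add: g_def sum.distrib)
  ultimately have "flow g" unfolding flow_def by blast
  moreover have "val g = val f + 1" using val_path_flow(1)[OF xs(2,1,3-5)]
    by (simp add: val_def g_def sum.distrib)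
  ultimately show ?thesis by blast
qed

lemma flow_of_value:
  assumes cut: "\<And>S. A \<subseteq> S \<Longrightarrow> S \<subseteq> V \<Longrightarrow> S \<inter> B = {} \<Longrightarrow> m \<le> card {(u, w). E u w \<and> u \<in> S \<and> w \<notin> S}"
    and "k \<le> m"
  shows "\<exists>f. flow f \<and> val f = int k"
  using assms(2)
proof (induction k)
  case 0
  have "flow (\<lambda>u v. 0) \<and> val (\<lambda>u v. 0) = int 0" by (simp add: flow_def val_def)
  then show ?case by blast
next
  case (Suc k)
  then obtain f where "flow f" "val f = int k" by auto
  moreover from this have "\<exists>g. flow g \<and> val g = val f + 1" using Suc.prems by (intro augment[OF _ _ cut]) auto
  ultimately show ?case by auto
qed

text \<open>Subtracting a path along arcs of flow 1 leaves flow 0 on them in both directions, so the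
  paths found later avoid them.\<close>

lemma disjoint_paths_of_flow:
  assumes "flow f" "val f = int k"
  shows "\<exists>ps :: nat \<Rightarrow> 'v list.
    (\<forall>i < k. ps i \<noteq> [] \<and> distinct (ps i) \<and> set (ps i) \<subseteq> V \<and> hd (ps i) \<in> A \<and> last (ps i) \<in> B \<and>
       (\<forall>(u, v) \<in> arcs (ps i). f u v = 1)) \<and>
    (\<forall>i < k. \<forall>j < k. i \<noteq> j \<longrightarrow> arcs (ps i) \<inter> arcs (ps j) = {})"
  using assms
proof (induction k arbitrary: f)
  case 0
  then show ?case by simp
next
  case (Suc k)
  note f = Suc.prems(1)
  have anti: "f u v = - f v u" and le: "f u v \<le> 1" and fE: "f u v \<noteq> 0 \<Longrightarrow> E u v" for u v
    using f unfolding flow_def by blast+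
  have cons: "(\<Sum>w\<in>V. f v w) = 0" if "v \<in> V - A - B" for v using f that unfolding flow_def by blast
  let ?R = "\<lambda>u v. f u v = 1"
  have no: False if S: "A \<subseteq> S" "S \<subseteq> V" "S \<inter> B = {}" and cl: "\<forall>u\<in>S. \<forall>v. ?R u v \<longrightarrow> v \<in> S" for S
  proof -
    have "f u w \<le> 0" if "u \<in> S" "w \<in> V - S" for u w
    proof -
      have "f u w \<noteq> 1" using cl that by blast
      then show ?thesis using le[of u w] by linarith
    qed
    then have "val f \<le> 0" unfolding val_cut[OF f S] by (intro sum_nonpos) auto
    then show False using Suc.prems(2) by simp
  qed
  have "\<And>u v. f u v = 1 \<Longrightarrow> E u v" using fE by simp
  then obtain xs where xs: "xs \<noteq> []" "distinct xs" "set xs \<subseteq> V" "hd xs \<in> A" "last xs \<in> B"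
    "\<forall>(u, v) \<in> arcs xs. f u v = 1"
    using path_or_closed[of ?R] no by blast
  define g where "g u v = f u v - path_flow xs u v" for u v
  have gv: "g u v = (if (u, v) \<in> arcs xs \<or> (v, u) \<in> arcs xs then 0 else f u v)" for u v
  proof -
    have "(v, u) \<in> arcs xs \<longrightarrow> f v u = 1" "(u, v) \<in> arcs xs \<longrightarrow> f u v = 1" using xs(6) by auto
    then show ?thesis using anti[of u v] arcs_antisym[OF xs(2), of u v]
      by (auto simp: g_def path_flow_def)
  qed
  have "g u v = - g v u \<and> g u v \<le> 1 \<and> (g u v \<noteq> 0 \<longrightarrow> E u v)" for u v
    using anti[of u v] le[of u v] fE[of u v] by (auto simp: gv)
  moreover have "(\<Sum>w\<in>V. g v w) = 0" if "v \<in> V - A - B" for v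
    using cons[OF that] val_path_flow(2)[OF xs(2,1,3-5) that] by (simp add: g_def sum_subtractf)
  ultimately have "flow g" unfolding flow_def by blast
  moreover have "val g = int k" using val_path_flow(1)[OF xs(2,1,3-5)] Suc.prems(2)
    by (simp add: val_def g_def sum_subtractf)
  ultimately obtain ps :: "nat \<Rightarrow> 'v list" where
    ps: "\<forall>i < k. ps i \<noteq> [] \<and> distinct (ps i) \<and> set (ps i) \<subseteq> V \<and> hd (ps i) \<in> A \<and> last (ps i) \<in> B \<and>
       (\<forall>(u, v) \<in> arcs (ps i). g u v = 1)"
    and dis: "\<forall>i < k. \<forall>j < k. i \<noteq> j \<longrightarrow> arcs (ps i) \<inter> arcs (ps j) = {}"
    using Suc.IH by metis
  have g1: "f u v = 1 \<and> (u, v) \<notin> arcs xs" if "g u v = 1" for u v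
    using that gv[of u v] by (auto split: if_splits)
  let ?ps = "ps(k := xs)"
  have 1: "?ps i \<noteq> [] \<and> distinct (?ps i) \<and> set (?ps i) \<subseteq> V \<and> hd (?ps i) \<in> A \<and> last (?ps i) \<in> B \<and>
       (\<forall>(u, v) \<in> arcs (?ps i). f u v = 1)" if "i < Suc k" for i
  proof (cases "i = k")
    case True
    then show ?thesis using xs by simp
  next
    case False
    then have "i < k" using that by simp
    moreover from this have "\<forall>(u, v) \<in> arcs (ps i). f u v = 1" using ps g1 by blast
    ultimately show ?thesis using ps False by simp
  qed
  have new: "arcs (ps i) \<inter> arcs xs = {}" if "i < k" for i
  proof -
    have "(u, v) \<notin> arcs xs" if "(u, v) \<in> arcs (ps i)" for u v
    proof -
      have "g u v = 1" using ps \<open>i < k\<close> that by blast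
      then show ?thesis using g1 by blast
    qed
    then show ?thesis by auto
  qed
  have 2: "arcs (?ps i) \<inter> arcs (?ps j) = {}" if "i < Suc k" "j < Suc k" "i \<noteq> j" for i j
  proof -
    have "arcs (ps i) \<inter> arcs (ps j) = {}" if "i < k" "j < k" using dis that \<open>i \<noteq> j\<close> by blast
    then show ?thesis using that new[of i] new[of j] by (cases "i = k"; cases "j = k") (auto simp: Int_commute)
  qed
  show ?case using 1 2 by (intro exI[of _ ?ps]) blast
qed

text \<open>This is the edge version of Menger's theorem. The converse relation expresses that no
  edge is shared in opposite directions either, which holds because \<open>f u v\<close> and
  \<open>f v u\<close> cannot both be 1.\<close>

theorem edge_disjoint_paths:
  assumes "\<And>S. A \<subseteq> S \<Longrightarrow> S \<subseteq> V \<Longrightarrow> S \<inter> B = {} \<Longrightarrow> m \<le> card {(u, w). E u w \<and> u \<in> S \<and> w \<notin> S}"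
  shows "\<exists>ps :: nat \<Rightarrow> 'v list.
    (\<forall>i < m. ps i \<noteq> [] \<and> distinct (ps i) \<and> set (ps i) \<subseteq> V \<and> hd (ps i) \<in> A \<and> last (ps i) \<in> B \<and>
       (\<forall>(u, v) \<in> arcs (ps i). E u v)) \<and>
    (\<forall>i < m. \<forall>j < m. i \<noteq> j \<longrightarrow> arcs (ps i) \<inter> (arcs (ps j) \<union> (arcs (ps j))\<inverse>) = {})"
proof -
  obtain f where f: "flow f" "val f = int m" using flow_of_value[OF assms] by blast
  obtain ps :: "nat \<Rightarrow> 'v list" where
    ps: "\<forall>i < m. ps i \<noteq> [] \<and> distinct (ps i) \<and> set (ps i) \<subseteq> V \<and> hd (ps i) \<in> A \<and> last (ps i) \<in> B \<and>
       (\<forall>(u, v) \<in> arcs (ps i). f u v = 1)"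
    and dis: "\<forall>i < m. \<forall>j < m. i \<noteq> j \<longrightarrow> arcs (ps i) \<inter> arcs (ps j) = {}"
    using disjoint_paths_of_flow[OF f] by blast
  have anti: "f u v = - f v u" and fE: "f u v \<noteq> 0 \<Longrightarrow> E u v" for u v
    using f(1) unfolding flow_def by blast+
  have rev: "(v, u) \<notin> arcs (ps j)" if "i < m" "j < m" "(u, v) \<in> arcs (ps i)" for i j u v
  proof
    assume "(v, u) \<in> arcs (ps j)"
    then have "f v u = 1" "f u v = 1" using ps that by blast+
    then show False using anti[of u v] by simp
  qed
  have dis': "arcs (ps i) \<inter> (arcs (ps j) \<union> (arcs (ps j))\<inverse>) = {}" if "i < m" "j < m" "i \<noteq> j" for i j
  proof -
    have "arcs (ps i) \<inter> arcs (ps j) = {}" using dis that by blast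
    then show ?thesis using rev[OF that(1,2)] by auto
  qed
  have "ps i \<noteq> [] \<and> distinct (ps i) \<and> set (ps i) \<subseteq> V \<and> hd (ps i) \<in> A \<and> last (ps i) \<in> B \<and>
      (\<forall>(u, v) \<in> arcs (ps i). E u v)" if "i < m" for i
  proof -
    have "E u v" if "(u, v) \<in> arcs (ps i)" for u v
    proof -
      have "f u v = 1" using ps \<open>i < m\<close> that by blast
      then show ?thesis using fE by simp
    qed
    then show ?thesis using ps that by auto
  qed
  then show ?thesis using dis' by (intro exI[of _ ps]) simp
qed

end

section \<open>Snarks\<close>

definition graph :: "pole \<Rightarrow> (nat, nat) multigraph" where
  "graph p = \<lparr>verts = {..<nv p}, edges = {..<ne p}, ends = owners p\<rparr>"

lemma graph_simps [simp]:
  "verts (graph p) = {..<nv p}" "edges (graph p) = {..<ne p}" "ends (graph p) = owners p"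
  by (simp_all add: graph_def)

text \<open>The empty distance table says that no strand is left, so every edge has two
  owners.\<close>

locale snark_pole =
  fixes q :: pole and n :: nat
  assumes good: "good q n CZ (BL 0 0 0 4) []" and nonempty: "0 < nv q"
begin

lemma wf: "wf_pole q"
  using good by (simp add: good_def)

lemma str_empty: "str q = []"
  using good by (simp add: good_def distance_bound_def)

lemma card_owners: "e < ne q \<Longrightarrow> card (owners q e) = 2"
  using wf str_empty by (simp add: wf_pole_def)

lemma owners_edge: "v \<in> owners q e \<Longrightarrow> e < ne q"
  using owners_new[OF wf, of e] by (metis empty_iff not_less)

lemma owners_eq: "u \<in> owners q e \<Longrightarrow> v \<in> owners q e \<Longrightarrow> u \<noteq> v \<Longrightarrow> owners q e = {u, v}"
proof -
  assume a: "u \<in> owners q e" "v \<in> owners q e" "u \<noteq> v"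
  have "card (owners q e) = card {u, v}" using card_owners owners_edge a by simp
  then show ?thesis using a by (intro card_subset_eq[symmetric]) auto
qed

lemma parallel: "u \<noteq> v \<Longrightarrow> u \<in> owners q e \<Longrightarrow> v \<in> owners q e \<Longrightarrow> u \<in> owners q f \<Longrightarrow> v \<in> owners q f \<Longrightarrow> e = f"
  using good unfolding good_def no_short_cycles_def by blast

lemma edges_at: "v < nv q \<Longrightarrow> {e \<in> edges (graph q). v \<in> ends (graph q) e} = set (inc q v)"
  using wf by (auto simp: owners_def wf_pole_def)

lemma card_inc: "v < nv q \<Longrightarrow> card (set (inc q v)) = 3"
  using wf by (auto simp: wf_pole_def distinct_card)

lemma adj_lt: "adj q u v \<Longrightarrow> u < nv q \<and> v < nv q"
  using owners_nv by (auto simp: adj_def)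

lemma other_end:
  assumes "u \<in> owners q e"
  obtains v where "owners q e = {u, v}" "u \<noteq> v"
proof -
  have "card (owners q e) = 2" using assms owners_edge card_owners by blast
  then obtain x y where "owners q e = {x, y}" "x \<noteq> y" by (auto simp: card_2_iff)
  then show ?thesis using that assms by (cases "u = x") (auto simp: insert_commute)
qed

text \<open>The flow argument counts adjacent pairs of vertices, the cut bound counts edge numbers;
  without parallel edges, a pair determines its edge.\<close>

lemma card_cut_le: "card (cut q S) \<le> card {(u, w). adj q u w \<and> u \<in> S \<and> w \<notin> S}"
proof -
  define g where "g e = (SOME x. fst x \<in> owners q e \<and> snd x \<in> owners q e \<and> fst x \<in> S \<and> snd x \<notin> S)" for e
  have g: "fst (g e) \<in> owners q e \<and> snd (g e) \<in> owners q e \<and> fst (g e) \<in> S \<and> snd (g e) \<notin> S"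
    if "e \<in> cut q S" for e
  proof -
    have "\<exists>x. fst x \<in> owners q e \<and> snd x \<in> owners q e \<and> fst x \<in> S \<and> snd x \<notin> S"
      using that by (auto simp: cut_def)
    from someI_ex[OF this] show ?thesis unfolding g_def .
  qed
  have "inj_on g (cut q S)"
  proof (rule inj_onI)
    fix e f assume "e \<in> cut q S" "f \<in> cut q S" "g e = g f"
    moreover from this have "fst (g e) \<noteq> snd (g e)" using g[of e] by metis
    ultimately show "e = f" using g[of e] g[of f] parallel[of "fst (g e)" "snd (g e)" e f] by metis
  qed
  moreover have "g ` cut q S \<subseteq> {(u, w). adj q u w \<and> u \<in> S \<and> w \<notin> S}"
  proof (rule image_subsetI)
    fix e assume e: "e \<in> cut q S"
    then have "fst (g e) \<noteq> snd (g e)" using g by metis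
    then have "adj q (fst (g e)) (snd (g e)) \<and> fst (g e) \<in> S \<and> snd (g e) \<notin> S"
      using g[OF e] unfolding adj_def by blast
    then show "g e \<in> {(u, w). adj q u w \<and> u \<in> S \<and> w \<notin> S}" by (simp add: case_prod_beta)
  qed
  moreover have "finite {(u, w). adj q u w \<and> u \<in> S \<and> w \<notin> S}"
    by (rule finite_subset[of _ "{..<nv q} \<times> {..<nv q}"]) (use adj_lt in auto)
  ultimately show ?thesis by (rule card_inj_on_le)
qed

lemma paths_of_cuts:
  assumes A: "A \<subseteq> {..<nv q}" and B: "B \<subseteq> {..<nv q}" and AB: "A \<inter> B = {}"
    and cuts: "\<And>S. A \<subseteq> S \<Longrightarrow> S \<subseteq> {..<nv q} \<Longrightarrow> S \<inter> B = {} \<Longrightarrow> m \<le> card (cut q S)"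
  shows "edge_connected_to (graph q) m A B"
proof -
  interpret terminals "{..<nv q}" "adj q" A B
  proof
    show "adj q v u" if "adj q u v" for u v using that adj_sym[of q u v] by simp
    show "u \<in> {..<nv q}" if "adj q u v" for u v using that adj_lt by simp
  qed (use A B AB in auto)
  have cuts': "m \<le> card {(u, w). adj q u w \<and> u \<in> S \<and> w \<notin> S}"
    if "A \<subseteq> S" "S \<subseteq> {..<nv q}" "S \<inter> B = {}" for S
    using cuts[OF that] card_cut_le[of S] by (rule le_trans)
  obtain ps :: "nat \<Rightarrow> nat list" where
    ps: "\<forall>i < m. ps i \<noteq> [] \<and> distinct (ps i) \<and> set (ps i) \<subseteq> {..<nv q} \<and> hd (ps i) \<in> A \<and> last (ps i) \<in> B \<and>
       (\<forall>(u, v) \<in> arcs (ps i). adj q u v)"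
    and dis: "\<forall>i < m. \<forall>j < m. i \<noteq> j \<longrightarrow> arcs (ps i) \<inter> (arcs (ps j) \<union> (arcs (ps j))\<inverse>) = {}"
    using edge_disjoint_paths[OF cuts'] by blast
  define edge where "edge u v = (SOME e. u \<in> owners q e \<and> v \<in> owners q e)" for u v
  have edge: "owners q (edge u v) = {u, v} \<and> edge u v < ne q" if "adj q u v" for u v
  proof -
    have "u \<in> owners q (edge u v) \<and> v \<in> owners q (edge u v)"
      unfolding edge_def using that by (intro someI_ex[of "\<lambda>e. u \<in> owners q e \<and> v \<in> owners q e"]) (auto simp: adj_def)
    then show ?thesis using owners_eq owners_edge that by (auto simp: adj_def)
  qed
  define es where "es i = map (\<lambda>(u, v). edge u v) (zip (ps i) (tl (ps i)))" for i
  have set_es: "set (es i) = (\<lambda>(u, v). edge u v) ` arcs (ps i)" for i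
    by (simp add: es_def arcs_def)
  have "path (graph q) (ps i) (es i)" if i: "i < m" for i
  proof -
    have a: "adj q u v" if "(u, v) \<in> arcs (ps i)" for u v using ps i that by blast
    have len: "length (ps i) = Suc (length (es i))" using ps i by (cases "ps i") (auto simp: es_def)
    have "owners q (es i ! k) = {ps i ! k, ps i ! Suc k}" if k: "k < length (es i)" for k
    proof -
      have "zip (ps i) (tl (ps i)) ! k = (ps i ! k, ps i ! Suc k)" and
        "k < length (zip (ps i) (tl (ps i)))"
        using k len by (auto simp: nth_tl)
      moreover from this have "(ps i ! k, ps i ! Suc k) \<in> arcs (ps i)"
        unfolding arcs_def by (metis nth_mem)
      ultimately show ?thesis using edge[OF a] by (simp add: es_def)
    qed
    moreover have "set (es i) \<subseteq> {..<ne q}" using edge a unfolding set_es by auto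
    ultimately show ?thesis using ps i len by (simp add: path_def walk_def)
  qed
  moreover have "set (es i) \<inter> set (es j) = {}" if ij: "i < m" "j < m" "i \<noteq> j" for i j
  proof (rule equals0I)
    fix e assume "e \<in> set (es i) \<inter> set (es j)"
    then obtain u v u' v' where uv: "(u, v) \<in> arcs (ps i)" "(u', v') \<in> arcs (ps j)"
      "e = edge u v" "e = edge u' v'" unfolding set_es by auto
    then have "adj q u v" "adj q u' v'" using ps ij by blast+
    then have "{u, v} = {u', v'}" using edge uv by metis
    then have "(u, v) \<in> arcs (ps j) \<union> (arcs (ps j))\<inverse>" using uv by (auto simp: doubleton_eq_iff)
    then show False using dis ij uv(1) by blast
  qed
  ultimately show ?thesis using ps unfolding edge_connected_to_def by (intro exI[of _ ps] exI[of _ es]) auto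
qed

lemma cut_ge_4:
  assumes "S \<subseteq> {..<nv q}" "inner_edge q S" "inner_edge q ({..<nv q} - S)"
  shows "4 \<le> card (cut q S)"
proof -
  have "admits (BL 0 0 0 4) (map (touches q S) (str q)) True True (card (cut q S))"
    using good assms unfolding good_def cut_bound_def by blast
  then show ?thesis by (simp add: str_empty)
qed

text \<open>The cut bound is silent if one side contains no edge, but then every edge at a vertex of
  that side leaves it.\<close>

lemma cut_ge_1:
  assumes "S \<subseteq> {..<nv q}" "u \<in> S" "v \<in> {..<nv q} - S"
  shows "1 \<le> card (cut q S)"
proof -
  have fin: "finite (cut q S)" using finite_cut[OF wf] .
  have *: "cut q S \<noteq> {}" if "w < nv q" "w \<in> T" "\<not> inner_edge q T" "T = S \<or> T = {..<nv q} - S" for w T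
  proof -
    have "set (inc q w) \<noteq> {}" using card_inc[OF that(1)] by auto
    then obtain e where "e \<in> set (inc q w)" by (meson all_not_in_conv)
    then have e: "w \<in> owners q e" using \<open>w < nv q\<close> by (simp add: owners_def)
    then obtain x where x: "owners q e = {w, x}" "w \<noteq> x" by (rule other_end)
    then have "x < nv q" using owners_nv[of x q e] by simp
    moreover have "x \<notin> T" using that x by (auto simp: inner_edge_def)
    ultimately have "e \<in> cut q S" using that x by (auto simp: cut_def)
    then show ?thesis by blast
  qed
  show ?thesis
  proof (cases "inner_edge q S \<and> inner_edge q ({..<nv q} - S)")
    case True
    then show ?thesis using cut_ge_4[of S] assms by simp
  next
    case False
    then have "cut q S \<noteq> {}" using *[of u S] *[of v "{..<nv q} - S"] assms by auto
    then show ?thesis using fin by (simp add: Suc_leI card_gt_0_iff)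
  qed
qed

lemma connected: "connected_graph (graph q)"
proof -
  have "\<exists>vs es. path (graph q) vs es \<and> hd vs = u \<and> last vs = v" if "u < nv q" "v < nv q" for u v
  proof (cases "u = v")
    case True
    then show ?thesis using that by (intro exI[of _ "[u]"] exI[of _ "[]"]) (simp add: path_def walk_def)
  next
    case False
    have "edge_connected_to (graph q) 1 {u} {v}"
      using that False cut_ge_1 by (intro paths_of_cuts) auto
    then obtain vs es where "\<forall>i<1::nat. path (graph q) (vs i) (es i) \<and> hd (vs i) \<in> {u} \<and> last (vs i) \<in> {v}"
      unfolding edge_connected_to_def by blast
    then show ?thesis by (intro exI[of _ "vs 0"] exI[of _ "es 0"]) simp
  qed
  then show ?thesis using nonempty unfolding connected_graph_def by auto
qed

lemma simple: "simple_graph (graph q)"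
proof -
  have "inj_on (owners q) {..<ne q}"
  proof (rule inj_onI)
    fix e f assume ef: "e \<in> {..<ne q}" "f \<in> {..<ne q}" "owners q e = owners q f"
    then obtain u v where "owners q e = {u, v}" "u \<noteq> v" using card_owners[of e] by (auto simp: card_2_iff)
    then show "e = f" using ef parallel[of u v e f] by auto
  qed
  then show ?thesis using connected card_owners
    by (auto simp: simple_graph_def wf_multigraph_def owners_def)
qed

lemma cubic_graph: "cubic (graph q)"
  unfolding cubic_def using edges_at card_inc by auto

lemma walk_adj:
  assumes "walk (graph q) vs es" "i < length es"
  shows "adj q (vs ! i) (vs ! Suc i)" "vs ! i \<in> owners q (es ! i)" "vs ! Suc i \<in> owners q (es ! i)"
proof -
  have o: "owners q (es ! i) = {vs ! i, vs ! Suc i}" and "es ! i \<in> set es" "set es \<subseteq> {..<ne q}"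
    using assms by (auto simp: walk_def)
  then have "card {vs ! i, vs ! Suc i} = 2" using card_owners[of "es ! i"] by auto
  then have "vs ! i \<noteq> vs ! Suc i" by auto
  then show "adj q (vs ! i) (vs ! Suc i)" "vs ! i \<in> owners q (es ! i)" "vs ! Suc i \<in> owners q (es ! i)"
    using o unfolding adj_def by auto
qed

lemma cycle_length: "cycle (graph q) vs es \<Longrightarrow> 5 \<le> length es"
proof (rule ccontr)
  assume c: "cycle (graph q) vs es" and short: "\<not> 5 \<le> length es"
  have w: "walk (graph q) vs es" and ne: "es \<noteq> []" and hl: "hd vs = last vs"
    and d: "distinct (tl vs)" "distinct es"
    using c unfolding cycle_def by blast+
  have l: "length vs = Suc (length es)" using w unfolding walk_def by blast
  have "length es \<noteq> 0" using ne by simp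
  then have L: "length es = 1 \<or> length es = 2 \<or> length es = 3 \<or> length es = 4" using short by linarith
  have a: "adj q (vs ! i) (vs ! Suc i)" if "i < length es" for i using walk_adj(1)[OF w that] .
  have ns: "no_short_cycles q" using good by (simp add: good_def)
  have sym: "adj q u v \<Longrightarrow> adj q v u" for u v using adj_sym by blast
  from L show False
  proof (elim disjE)
    assume "length es = 1"
    then obtain x y where "vs = [x, y]" using l by (auto simp: length_Suc_conv numeral_eq_Suc)
    then show False using a[of 0] hl \<open>length es = 1\<close> by (simp add: adj_def)
  next
    assume L: "length es = 2"
    then obtain x y z where vs: "vs = [x, y, z]" using l by (auto simp: length_Suc_conv numeral_eq_Suc)
    from L obtain e f where es: "es = [e, f]" by (auto simp: length_Suc_conv numeral_eq_Suc)
    have "x = z" using hl vs by simp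
    moreover have "x \<noteq> y" using a[of 0] L vs by (simp add: adj_def)
    ultimately have "e = f"
      using walk_adj(2,3)[OF w, of 0] walk_adj(2,3)[OF w, of 1] vs es parallel[of x y e f] by simp
    then show False using d es by simp
  next
    assume L: "length es = 3"
    then obtain x y z u where vs: "vs = [x, y, z, u]" using l by (auto simp: length_Suc_conv numeral_eq_Suc)
    then have "adj q x y" "adj q y z" "adj q z x" using a[of 0] a[of 1] a[of 2] L hl by auto
    then show False using ns sym unfolding no_short_cycles_def by blast
  next
    assume L: "length es = 4"
    then obtain x y z u t where vs: "vs = [x, y, z, u, t]" using l by (auto simp: length_Suc_conv numeral_eq_Suc)
    then have "adj q x y" "adj q y z" "adj q z u" "adj q u x"
      using a[of 0] a[of 1] a[of 2] a[of 3] L hl by auto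
    moreover have "y \<noteq> u" "x \<noteq> z" using d vs hl by auto
    moreover have "adj q x y \<Longrightarrow> adj q y z \<Longrightarrow> adj q x u \<Longrightarrow> adj q u z \<Longrightarrow> x \<noteq> z \<Longrightarrow> y = u"
      using ns unfolding no_short_cycles_def by blast
    ultimately show False using sym[of u x] sym[of z u] by blast
  qed
qed

lemma girth_ge_5: "5 \<le> girth (graph q)"
proof -
  have "(5::enat) \<le> enat (length es)" if "cycle (graph q) vs es" for vs es
    using cycle_length[OF that] by (metis enat_ord_simps(1) numeral_eq_enat)
  then show ?thesis unfolding girth_def by (intro Inf_greatest) blast
qed

lemma cycle_inner_edge:
  assumes "cycle (graph q) vs es" "set vs \<subseteq> S"
  shows "inner_edge q S"
proof -
  have w: "walk (graph q) vs es" "0 < length es" "length vs = Suc (length es)"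
    using assms by (auto simp: cycle_def walk_def)
  then have "vs ! 0 \<in> S" "vs ! Suc 0 \<in> S" using assms(2) by (auto intro!: subsetD[OF assms(2)] nth_mem)
  then show ?thesis using walk_adj[OF w(1,2)] unfolding inner_edge_def adj_def by blast
qed

lemma cyclically_4_connected: "cyclically_edge_connected (graph q) 4"
  unfolding cyclically_edge_connected_def
proof (intro allI impI, elim conjE)
  fix vs es vs' es'
  assume c: "cycle (graph q) vs es" "cycle (graph q) vs' es'" "set vs \<inter> set vs' = {}"
  have sub: "set vs \<subseteq> {..<nv q}" "set vs' \<subseteq> {..<nv q}"
    using c by (auto simp: cycle_def walk_def)
  show "edge_connected_to (graph q) 4 (set vs) (set vs')"
  proof (rule paths_of_cuts[OF sub c(3)])
    fix S assume "set vs \<subseteq> S" "S \<subseteq> {..<nv q}" "S \<inter> set vs' = {}"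
    moreover from this have "set vs' \<subseteq> {..<nv q} - S" using sub by blast
    ultimately show "4 \<le> card (cut q S)"
      using c cycle_inner_edge by (intro cut_ge_4) blast+
  qed
qed

lemma not_colourable: "\<not> three_edge_colourable (graph q)"
proof
  assume "three_edge_colourable (graph q)"
  then obtain c where c: "three_edge_colouring (graph q) c" by (auto simp: three_edge_colourable_def)
  let ?c = "restrict c {..<ne q}"
  have "distinct (map ?c (inc q v))" if v: "v < nv q" for v
  proof -
    have sub: "set (inc q v) \<subseteq> {..<ne q}" "distinct (inc q v)" using wf v by (auto simp: wf_pole_def)
    have "c e \<noteq> c f" if "e \<in> set (inc q v)" "f \<in> set (inc q v)" "e \<noteq> f" for e f
    proof -
      have "v \<in> owners q e \<inter> owners q f" using that v by (simp add: owners_def)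
      then have "adjacent_edges (graph q) e f" using that by (auto simp: adjacent_edges_def)
      then show ?thesis using c that sub unfolding three_edge_colouring_def by auto
    qed
    then have "inj_on ?c (set (inc q v))" using sub by (auto simp: inj_on_def)
    then show ?thesis using sub by (simp add: distinct_map)
  qed
  moreover have "?c \<in> {..<ne q} \<rightarrow>\<^sub>E {..<3}" using c by (auto simp: three_edge_colouring_def)
  ultimately have "?c \<in> colourings q []" by (simp add: colourings_def str_empty)
  moreover have "card (colourings q []) = 0" using good by (simp add: good_def counts_def str_empty)
  ultimately show False by simp
qed

theorem snark_graph: "snark (graph q)"
  unfolding snark_def
  using simple cubic_graph not_colourable girth_ge_5 cyclically_4_connected by blast

end

section \<open>Subtracting an edge of the closing pentagon\<close>

text \<open>Fixing the colours of three pairwise adjacent edges selects one colouring from each decomposition.\<close>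

lemma card_decompositions:
  fixes H :: "('v, 'e) multigraph"
  assumes x: "x 0 \<in> edges H" "x 1 \<in> edges H" "x 2 \<in> edges H"
    and adj: "adjacent_edges H (x 0) (x 1)" "adjacent_edges H (x 0) (x 2)" "adjacent_edges H (x 1) (x 2)"
  shows "card {P. three_edge_decomposition H P} =
    card {c \<in> edges H \<rightarrow>\<^sub>E {..<3 :: nat}. three_edge_colouring H c \<and> c (x 0) = 0 \<and> c (x 1) = 1 \<and> c (x (2 :: nat)) = 2}"
    (is "card ?D = card ?C")
proof -
  define cls where "cls c i = {f \<in> edges H. c f = i}" for c :: "'e \<Rightarrow> nat" and i
  define parts where "parts c = cls c ` {..<3}" for c
  have x': "x i \<in> edges H" if "i < 3" for i using x that by (auto simp: nat_less_3)
  have cx: "c (x i) = i" if "c \<in> ?C" "i < 3" for c i using that by (auto simp: nat_less_3)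
  have xcls: "x i \<in> cls c i" if "c \<in> ?C" "i < 3" for c i using x'[OF that(2)] cx[OF that] unfolding cls_def by blast
  have adj': "adjacent_edges H (x i) (x j)" if "i < 3" "j < 3" "i \<noteq> j" for i j
  proof -
    have "adjacent_edges H f e" if "adjacent_edges H e f" for e f
      using that by (auto simp: adjacent_edges_def)
    then show ?thesis using that adj unfolding nat_less_3 by (elim disjE) simp_all
  qed
  have inj: "inj_on parts ?C"
  proof (rule inj_onI)
    fix c d assume c: "c \<in> ?C" and d: "d \<in> ?C" and eq: "parts c = parts d"
    have same: "c f = d f" if f: "f \<in> edges H" for f
    proof -
      have lt: "c f < 3" using c f by (auto simp: PiE_iff)
      have "cls c (c f) \<in> parts d" using lt eq by (auto simp: parts_def)
      then obtain j where j: "j < 3" "cls c (c f) = cls d j" by (auto simp: parts_def)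
      then have "x (c f) \<in> cls d j" using xcls[OF c lt] by simp
      then have "j = c f" using cx[OF d lt] by (simp add: cls_def)
      moreover have "f \<in> cls c (c f)" using f by (simp add: cls_def)
      ultimately have "f \<in> cls d (c f)" using j(2) by simp
      then show ?thesis by (simp add: cls_def)
    qed
    have "c \<in> edges H \<rightarrow>\<^sub>E {..<3}" "d \<in> edges H \<rightarrow>\<^sub>E {..<3}" using c d by blast+
    then show "c = d" by (rule PiE_ext) (rule same)
  qed
  have im: "parts c \<in> ?D" if c: "c \<in> ?C" for c
  proof -
    have "inj_on (cls c) {..<3}"
    proof (rule inj_onI)
      fix i j assume "i \<in> {..<3}" "j \<in> {..<3}" "cls c i = cls c j"
      then show "i = j" using xcls[OF c, of i] cx[OF c, of i] by (auto simp: cls_def)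
    qed
    then have "card (parts c) = 3" by (simp add: parts_def card_image)
    moreover have "partition_on (edges H) (parts c)"
    proof (rule partition_onI)
      show "\<Union> (parts c) = edges H" using c by (auto simp: parts_def cls_def PiE_iff)
      show "{} \<notin> parts c" using xcls[OF c] by (fastforce simp: parts_def)
      show "disjnt A B" if "A \<in> parts c" "B \<in> parts c" "A \<noteq> B" for A B
        using that by (auto simp: parts_def cls_def disjnt_def)
    qed
    moreover have "\<not> adjacent_edges H e f" if "A \<in> parts c" "e \<in> A" "f \<in> A" for A e f
    proof
      assume "adjacent_edges H e f"
      moreover have "e \<in> edges H" "f \<in> edges H" "c e = c f" using that by (auto simp: parts_def cls_def)
      ultimately show False using c unfolding three_edge_colouring_def by blast
    qed
    ultimately show ?thesis by (simp add: three_edge_decomposition_def)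
  qed
  have sur: "P \<in> parts ` ?C" if P: "P \<in> ?D" for P
  proof -
    have part: "partition_on (edges H) P" and c3: "card P = 3"
      and na: "\<And>A e f. A \<in> P \<Longrightarrow> e \<in> A \<Longrightarrow> f \<in> A \<Longrightarrow> \<not> adjacent_edges H e f"
      using P by (auto simp: three_edge_decomposition_def)
    have "\<exists>A. A \<in> P \<and> x i \<in> A" if "i < 3" for i using x'[OF that] partition_onD1[OF part] by auto
    then obtain A where A: "A i \<in> P" "x i \<in> A i" if "i < 3" for i by metis
    have disj: "i = j" if "i < 3" "j < 3" "f \<in> A i" "f \<in> A j" for i j f
    proof (rule ccontr)
      assume "i \<noteq> j"
      have "A i = A j" using partition_onD2[OF part] A that unfolding disjoint_def by blast
      then show False using na[of "A i" "x i" "x j"] A adj' that \<open>i \<noteq> j\<close> by metis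
    qed
    have injA: "inj_on A {..<3}"
    proof (rule inj_onI)
      fix i j assume "i \<in> {..<3 :: nat}" "j \<in> {..<3}" "A i = A j"
      then show "i = j" using A(2)[of i] disj[of i j "x i"] by simp
    qed
    have "A ` {..<3} = P"
      using c3 A(1) card_image[OF injA] by (intro card_subset_eq) (auto intro: card_ge_0_finite)
    then have ex: "\<exists>i<3. f \<in> A i" if "f \<in> edges H" for f
      using that partition_onD1[OF part] by auto
    have AE: "f \<in> edges H" if "i < 3" "f \<in> A i" for i f using A(1) that partition_onD1[OF part] by blast
    \<comment> \<open>The marked edge \<open>x i\<close> names its class \<open>A i\<close>, so the
      colour of an edge is the index of the class containing it.\<close>
    define c where "c = restrict (\<lambda>f. THE i. i < 3 \<and> f \<in> A i) (edges H)"
    have cA: "c f = i" if "i < 3" "f \<in> A i" for f i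
      unfolding c_def using that AE disj by (auto intro!: the_equality)
    have "c \<in> edges H \<rightarrow>\<^sub>E {..<3}"
    proof
      fix f assume "f \<in> edges H"
      then obtain i where "i < 3" "f \<in> A i" using ex by blast
      then show "c f \<in> {..<3}" using cA by simp
    qed (simp add: c_def)
    moreover have "three_edge_colouring H c"
    proof -
      have "c e \<noteq> c f" if "e \<in> edges H" "f \<in> edges H" "adjacent_edges H e f" for e f
      proof
        assume eq: "c e = c f"
        obtain i j where ij: "i < 3" "e \<in> A i" "j < 3" "f \<in> A j" using ex \<open>e \<in> _\<close> \<open>f \<in> _\<close> by metis
        then have "i = j" using cA eq by metis
        then show False using na[OF A(1)[OF ij(1)] ij(2), of f] ij that by simp
      qed
      then show ?thesis using \<open>c \<in> edges H \<rightarrow>\<^sub>E {..<3}\<close> by (auto simp: three_edge_colouring_def)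
    qed
    moreover have "c (x i) = i" if "i < 3" for i using cA A(2) that by blast
    ultimately have "c \<in> ?C" by simp
    moreover have "cls c i = A i" if "i < 3" for i
    proof
      show "A i \<subseteq> cls c i" using that AE cA by (auto simp: cls_def)
      show "cls c i \<subseteq> A i"
      proof
        fix f assume "f \<in> cls c i"
        then have f: "f \<in> edges H" "c f = i" by (auto simp: cls_def)
        then obtain j where "j < 3" "f \<in> A j" using ex by blast
        then show "f \<in> A i" using cA f by auto
      qed
    qed
    then have "parts c = P" using \<open>A ` {..<3} = P\<close> by (auto simp: parts_def)
    ultimately show ?thesis by blast
  qed
  have "bij_betw parts ?C ?D" unfolding bij_betw_def using inj im sur by blast
  then show ?thesis by (rule bij_betw_same_card[symmetric])
qed

section \<open>The closing pentagon and the value of \<open>psi\<close>\<close>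

lemma extend_closing_steps:
  assumes "str p = [a, b, c, d, e]"
  defines "q \<equiv> fold extend closing_steps p"
  shows "nv q = nv p + 5" "ne q = ne p + 5"
    "inc q = (inc p)(nv p := [a, ne p, ne p + 1], nv p + 1 := [b, ne p, ne p + 2],
      nv p + 2 := [c, ne p + 2, ne p + 3], nv p + 3 := [d, ne p + 3, ne p + 4],
      nv p + 4 := [ne p + 4, ne p + 1, e])"
  unfolding q_def closing_steps_def using assms(1)
  by (simp_all add: pull_def numeral_eq_Suc)

text \<open>These are the patterns that remain possible after the subtraction. In the last one the
  single colours are neighbours, so the summands are 1, 1, 1 and 0.\<close>

lemma pentagon_counts_sum:
  "clookup pentagon_counts [0, 0, 2, 0, 1] + clookup pentagon_counts [0, 2, 0, 0, 1] +
   clookup pentagon_counts [1, 0, 2, 0, 0] + clookup pentagon_counts [1, 2, 0, 0, 0] = 3"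
  by code_simp

text \<open>These are the choices left at two vertices of the closing pentagon when the colours at
  their common neighbour are fixed.\<close>

lemma third_colours:
  fixes x y :: nat
  assumes "x < 3" "y < 3"
  shows "distinct [x, y, 1] \<Longrightarrow> y = 0 \<and> x = 2 \<or> y = 2 \<and> x = 0"
    and "distinct [2, x, y] \<Longrightarrow> x = 0 \<and> y = 1 \<or> x = 1 \<and> y = 0"
  using assms unfolding nat_less_3 by auto

text \<open>The edge \<open>ne p\<close> joins the first two vertices of the closing pentagon.
  Suppressing them fuses the first two strands with the adjoining pentagon edges, so only three
  pentagon vertices constrain the strands. Fixing the colours at the middle one leaves two choices
  at each of the others.\<close>

lemma psi_closed:
  assumes pole: "good p n pentagon_counts (cut_table 5 0) pentagon_distances"
  defines "q \<equiv> fold extend closing_steps p"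
  shows "snark (graph q)" "ne p \<in> edges (graph q)" "psi (graph q) (ne p) = n"
proof -
  define N where "N = nv p"
  define m where "m = ne p"
  have "length (str p) = 5" using pole by (simp add: good_def distance_bound_def pentagon_distances_def)
  then obtain a b c d e where str: "str p = [a, b, c, d, e]"
    by (auto simp: length_Suc_conv numeral_eq_Suc)
  note ext = extend_closing_steps[OF str, folded q_def N_def m_def]
  have wfp: "wf_pole p" using pole by (simp add: good_def)
  then have dist: "distinct [a, b, c, d, e]" and lt: "a < m" "b < m" "c < m" "d < m" "e < m"
    by (simp_all add: wf_pole_def str m_def)
  interpret snark_pole q n
    using closed_pole[OF pole, folded q_def] ext(1) by unfold_locales simp_all
  show "snark (graph q)" by (rule snark_graph)
  show "ne p \<in> edges (graph q)" using ext(2) by (simp add: m_def)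
  have inc_old: "inc q v = inc p v" if "v < N" for v using that by (simp add: ext(3))
  have inc_new: "inc q N = [a, m, m + 1]" "inc q (N + 1) = [b, m, m + 2]" "inc q (N + 2) = [c, m + 2, m + 3]"
    "inc q (N + 3) = [d, m + 3, m + 4]" "inc q (N + 4) = [m + 4, m + 1, e]"
    by (simp_all add: ext(3))
  have at: "v \<in> owners q f \<longleftrightarrow> v < N + 5 \<and> f \<in> set (inc q v)" for v f
    by (simp add: owners_def ext(1))
  have at_new: "N \<in> owners q f \<longleftrightarrow> f \<in> {a, m, m + 1}" "N + 1 \<in> owners q f \<longleftrightarrow> f \<in> {b, m, m + 2}"
    "N + 2 \<in> owners q f \<longleftrightarrow> f \<in> {c, m + 2, m + 3}" "N + 3 \<in> owners q f \<longleftrightarrow> f \<in> {d, m + 3, m + 4}"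
    "N + 4 \<in> owners q f \<longleftrightarrow> f \<in> {m + 4, m + 1, e}" for f
    unfolding at inc_new by auto
  have owners_new: "owners q m = {N, N + 1}" "owners q (m + 1) = {N, N + 4}" "owners q (m + 2) = {N + 1, N + 2}"
    by (rule owners_eq; (unfold at_new)?; simp)+
  define H where "H = edge_subtraction (graph q) m"
  define F where "F = {f. f < m + 5 \<and> f \<notin> {a, b, m, m + 1, m + 2}}"
  have vH: "verts H = {..<N + 5} - {N, N + 1}"
    by (simp add: H_def edge_subtraction_def owners_new ext(1))
  have eH: "edges H = Inl ` F \<union> {Inr N, Inr (N + 1)}"
  proof -
    have "{f \<in> {..<ne q}. owners q f \<inter> {N, N + 1} = {}} = F"
      using at_new(1,2) by (auto simp: F_def ext(2))
    then show ?thesis by (simp add: H_def edge_subtraction_def owners_new)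
  qed
  have endL: "ends H (Inl f) = owners q f" for f by (simp add: H_def edge_subtraction_def)
  have endR: "x \<in> ends H (Inr w) \<longleftrightarrow> x \<noteq> w \<and> (\<exists>f. f \<noteq> m \<and> w \<in> owners q f \<and> x \<in> owners q f)" for x w
  proof -
    have "x \<in> ends H (Inr w) \<longleftrightarrow> (\<exists>f. f < ne q \<and> f \<noteq> m \<and> owners q f = {w, x})"
      by (auto simp: H_def edge_subtraction_def)
    also have "\<dots> \<longleftrightarrow> x \<noteq> w \<and> (\<exists>f. f \<noteq> m \<and> w \<in> owners q f \<and> x \<in> owners q f)"
    proof
      assume "\<exists>f. f < ne q \<and> f \<noteq> m \<and> owners q f = {w, x}"
      then obtain f where f: "f < ne q" "f \<noteq> m" "owners q f = {w, x}" by blast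
      then have "card {w, x} = 2" using card_owners by metis
      then have "x \<noteq> w" by auto
      then show "x \<noteq> w \<and> (\<exists>f. f \<noteq> m \<and> w \<in> owners q f \<and> x \<in> owners q f)" using f by blast
    next
      assume "x \<noteq> w \<and> (\<exists>f. f \<noteq> m \<and> w \<in> owners q f \<and> x \<in> owners q f)"
      then obtain f where "x \<noteq> w" "f \<noteq> m" "w \<in> owners q f" "x \<in> owners q f" by blast
      then show "\<exists>f. f < ne q \<and> f \<noteq> m \<and> owners q f = {w, x}" using owners_eq owners_edge by metis
    qed
    finally show ?thesis .
  qed
  \<comment> \<open>\<open>\<iota> f\<close> is the edge of \<open>H\<close> into which the edge \<open>f\<close> of \<open>graph q\<close> is absorbed.\<close>
  define \<iota> :: "nat \<Rightarrow> nat + nat" where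
    "\<iota> f = (if f \<in> {a, m + 1} then Inr N else if f \<in> {b, m + 2} then Inr (N + 1) else Inl f)" for f
  have ne_m: "a \<noteq> m" "m + 1 \<noteq> m" "b \<noteq> m" "m + 2 \<noteq> m" using lt by auto
  have endN: "x \<in> ends H (Inr N) \<longleftrightarrow> x \<noteq> N \<and> (x \<in> owners q a \<or> x \<in> owners q (m + 1))" for x
    unfolding endR at_new(1) using ne_m by blast
  have endN1: "x \<in> ends H (Inr (N + 1)) \<longleftrightarrow> x \<noteq> N + 1 \<and> (x \<in> owners q b \<or> x \<in> owners q (m + 2))" for x
    unfolding endR at_new(2) using ne_m by blast
  have \<iota>_edge: "\<iota> f \<in> edges H" if "f < m + 5" "f \<noteq> m" for f
    using that by (auto simp: \<iota>_def eH F_def)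
  have incident: "E \<in> edges H \<and> v \<in> ends H E \<longleftrightarrow> E \<in> \<iota> ` set (inc q v)" if v: "v \<in> verts H" for v E
  proof
    have vN: "v < N + 5" "v \<noteq> N" "v \<noteq> N + 1" using v vH by auto
    {
      assume E: "E \<in> edges H \<and> v \<in> ends H E"
      then consider f where "f \<in> F" "E = Inl f" | "E = Inr N" | "E = Inr (N + 1)" by (auto simp: eH)
      then show "E \<in> \<iota> ` set (inc q v)"
      proof cases
        case 1
        then have "v \<in> owners q f" "\<iota> f = Inl f" using E endL by (auto simp: F_def \<iota>_def)
        then show ?thesis using 1 at by (metis image_eqI)
      next
        case 2
        then obtain f where "v \<in> owners q f" "f \<in> {a, m + 1}" using E endN by blast
        then have "f \<in> set (inc q v)" "\<iota> f = E" using 2 at by (auto simp: \<iota>_def)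
        then show ?thesis by blast
      next
        case 3
        then obtain f where "v \<in> owners q f" "f \<in> {b, m + 2}" using E endN1 by blast
        then have "f \<in> set (inc q v)" "\<iota> f = E" using 3 at lt dist by (auto simp: \<iota>_def)
        then show ?thesis by blast
      qed
    next
      assume "E \<in> \<iota> ` set (inc q v)"
      then obtain f where f: "f \<in> set (inc q v)" "E = \<iota> f" by blast
      then have vf: "v \<in> owners q f" using at vN by blast
      then have "f < m + 5" using owners_edge ext(2) by metis
      moreover have "f \<noteq> m" using vf owners_new vN by auto
      ultimately have "E \<in> edges H" using \<iota>_edge f by blast
      moreover have "v \<in> ends H E"
        unfolding f(2) \<iota>_def using vf vN endN endN1 endL by auto
      ultimately show "E \<in> edges H \<and> v \<in> ends H E" ..
    }
  qed
  have ends_verts: "ends H E \<subseteq> verts H" if E: "E \<in> edges H" for E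
  proof
    fix x assume x: "x \<in> ends H E"
    have sm: "x < N + 5" if "x \<in> owners q f" for f using that at by blast
    from E consider f where "f \<in> F" "E = Inl f" | "E = Inr N" | "E = Inr (N + 1)" by (auto simp: eH)
    then show "x \<in> verts H"
    proof cases
      case 1
      then have xf: "x \<in> owners q f" using x endL by simp
      have "x \<noteq> N" "x \<noteq> N + 1" using xf at_new(1,2)[of f] 1 by (auto simp: F_def)
      then show ?thesis using sm[OF xf] vH by simp
    next
      case 2
      then have x': "x \<noteq> N" "x \<in> owners q a \<or> x \<in> owners q (m + 1)" using x endN by auto
      then have "x \<noteq> N + 1" using at_new(2)[of a] at_new(2)[of "m + 1"] lt dist by auto
      then show ?thesis using x' sm vH by auto
    next
      case 3
      then have x': "x \<noteq> N + 1" "x \<in> owners q b \<or> x \<in> owners q (m + 2)" using x endN1 by auto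
      then have "x \<noteq> N" using at_new(1)[of b] at_new(1)[of "m + 2"] lt dist by auto
      then show ?thesis using x' sm vH by auto
    qed
  qed
  have inj: "inj_on \<iota> (set (inc q v))" if v: "v \<in> verts H" for v
  proof -
    have vN: "v < N + 5" "v \<noteq> N" "v \<noteq> N + 1" using v vH by auto
    \<comment> \<open>The far end of \<open>m + 1\<close> is \<open>N + 4\<close>, whose other edges
      are \<open>m + 4\<close> and \<open>e\<close>. Hence the two edges fused into
      \<open>Inr N\<close> do not meet again, and \<open>Inr N\<close> is no loop.\<close>
    have 1: "\<not> (a \<in> set (inc q v) \<and> m + 1 \<in> set (inc q v))"
    proof
      assume *: "a \<in> set (inc q v) \<and> m + 1 \<in> set (inc q v)"
      then have "v \<in> owners q (m + 1)" "v \<in> owners q a" using at vN by blast+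
      then have "v = N + 4" "N + 4 \<in> owners q a" using owners_new vN by auto
      then show False using at_new(5)[of a] lt dist by auto
    qed
    have 2: "\<not> (b \<in> set (inc q v) \<and> m + 2 \<in> set (inc q v))"
    proof
      assume *: "b \<in> set (inc q v) \<and> m + 2 \<in> set (inc q v)"
      then have "v \<in> owners q (m + 2)" "v \<in> owners q b" using at vN by blast+
      then have "v = N + 2" "N + 2 \<in> owners q b" using owners_new vN by auto
      then show False using at_new(3)[of b] lt dist by auto
    qed
    show ?thesis
      by (rule inj_onI) (use 1 2 in \<open>auto simp: \<iota>_def split: if_splits\<close>)
  qed
  \<comment> \<open>By \<open>incident\<close> and \<open>inj\<close>, being proper can be tested
    vertex by vertex on the incidence lists of \<open>q\<close>, the form in which poles are
    coloured.\<close>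
  have col: "three_edge_colouring H C \<longleftrightarrow>
      C \<in> edges H \<rightarrow> {..<3} \<and> (\<forall>v \<in> verts H. distinct (map (C \<circ> \<iota>) (inc q v)))" for C
  proof (intro iffI conjI ballI)
    assume C: "three_edge_colouring H C"
    then show "C \<in> edges H \<rightarrow> {..<3}" by (simp add: three_edge_colouring_def)
    fix v assume v: "v \<in> verts H"
    have "inj_on C (\<iota> ` set (inc q v))"
    proof (rule inj_onI)
      fix E E' assume *: "E \<in> \<iota> ` set (inc q v)" "E' \<in> \<iota> ` set (inc q v)" "C E = C E'"
      then have "E \<in> edges H" "v \<in> ends H E" "E' \<in> edges H" "v \<in> ends H E'" using incident[OF v] by blast+
      then show "E = E'" using C *(3) unfolding three_edge_colouring_def adjacent_edges_def by blast
    qed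
    then have "inj_on (C \<circ> \<iota>) (set (inc q v))" using inj[OF v] by (simp add: comp_inj_on)
    moreover have "distinct (inc q v)" using wf v vH ext(1) by (auto simp: wf_pole_def)
    ultimately show "distinct (map (C \<circ> \<iota>) (inc q v))" by (simp add: distinct_map)
  next
    assume C: "C \<in> edges H \<rightarrow> {..<3} \<and> (\<forall>v \<in> verts H. distinct (map (C \<circ> \<iota>) (inc q v)))"
    have "C E \<noteq> C E'" if E: "E \<in> edges H" "E' \<in> edges H" "adjacent_edges H E E'" for E E'
    proof -
      obtain x where x: "x \<in> ends H E" "x \<in> ends H E'" and ne: "E \<noteq> E'" using E by (auto simp: adjacent_edges_def)
      have xH: "x \<in> verts H" using x E ends_verts by blast
      obtain f g where fg: "f \<in> set (inc q x)" "g \<in> set (inc q x)" "E = \<iota> f" "E' = \<iota> g"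
        using incident[OF xH] x E by blast
      have "inj_on (C \<circ> \<iota>) (set (inc q x))" using C xH by (simp add: distinct_map)
      then show ?thesis using fg ne unfolding inj_on_def comp_apply by metis
    qed
    then show "three_edge_colouring H C" using C by (simp add: three_edge_colouring_def)
  qed
  \<comment> \<open>With 0, 1, 2 on \<open>d\<close>, \<open>m + 3\<close>, \<open>m + 4\<close>,
    the vertex \<open>N + 2\<close> forces the colours 0 and 2 on \<open>b\<close> and
    \<open>c\<close>, and \<open>N + 4\<close> forces 0 and 1 on \<open>a\<close> and
    \<open>e\<close>.\<close>
  define B :: "nat list set" where "B = {[0, 0, 2, 0, 1], [0, 2, 0, 0, 1], [1, 0, 2, 0, 0], [1, 2, 0, 0, 0]}"
  define NS where "NS = {C \<in> edges H \<rightarrow>\<^sub>E {..<3 :: nat}. three_edge_colouring H C \<and>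
      C (Inl d) = 0 \<and> C (Inl (m + 3)) = 1 \<and> C (Inl (m + 4)) = 2}"
  have \<iota>s: "\<iota> a = Inr N" "\<iota> (m + 1) = Inr N" "\<iota> b = Inr (N + 1)" "\<iota> (m + 2) = Inr (N + 1)" "\<iota> d = Inl d"
    "\<iota> (m + 3) = Inl (m + 3)" "\<iota> (m + 4) = Inl (m + 4)"
    using lt dist by (auto simp: \<iota>_def)
  have new_verts: "N + 2 \<in> verts H" "N + 3 \<in> verts H" "N + 4 \<in> verts H" by (auto simp: vH)
  have old_verts: "v \<in> verts H" if "v < N" for v using that by (auto simp: vH)
  have vH_cases: "v < N \<or> v = N + 2 \<or> v = N + 3 \<or> v = N + 4" if "v \<in> verts H" for v
    using that by (auto simp: vH)
  have F_edges: "Inl d \<in> edges H" "Inl (m + 3) \<in> edges H" "Inl (m + 4) \<in> edges H"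
    using lt dist by (auto simp: eH F_def)
  have inc_lt: "set (inc p v) \<subseteq> {..<m}" if "v < N" for v
    using wfp that by (simp add: wf_pole_def m_def N_def)
  define \<Phi> where "\<Phi> C = restrict (C \<circ> \<iota>) {..<m}" for C :: "nat + nat \<Rightarrow> nat"
  \<comment> \<open>The edges \<open>m + 3\<close> and \<open>m + 4\<close> have no counterpart in
    \<open>p\<close> and receive their prescribed colours; the fused edges take those of
    \<open>a\<close> and \<open>b\<close>.\<close>
  define \<Psi> where "\<Psi> k = restrict (\<lambda>E. case E of Inl f \<Rightarrow> if f = m + 3 then 1 else if f = m + 4 then 2 else k f
      | Inr w \<Rightarrow> if w = N then k a else k b) (edges H)" for k :: "nat \<Rightarrow> nat"
  have "bij_betw \<Phi> NS (\<Union>b\<in>B. colourings p b)"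
  proof (rule bij_betw_byWitness[where f' = \<Psi>])
    show "\<forall>C\<in>NS. \<Psi> (\<Phi> C) = C"
    proof
      fix C assume C: "C \<in> NS"
      show "\<Psi> (\<Phi> C) = C"
      proof
        fix E
        show "\<Psi> (\<Phi> C) E = C E"
        proof (cases "E \<in> edges H")
          case True
          then consider f where "f \<in> F" "E = Inl f" | "E = Inr N" | "E = Inr (N + 1)" by (auto simp: eH)
          then show ?thesis
          proof cases
            case 1
            then have "f = m + 3 \<or> f = m + 4 \<or> f < m \<and> \<iota> f = Inl f" by (auto simp: F_def \<iota>_def)
            then show ?thesis using 1 True C by (auto simp: \<Psi>_def \<Phi>_def NS_def)
          qed (use True lt \<iota>s in \<open>simp_all add: \<Psi>_def \<Phi>_def\<close>)
        next
          case False
          then show ?thesis using C by (auto simp: \<Psi>_def NS_def PiE_def extensional_def)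
        qed
      qed
    qed
    have \<Psi>\<iota>: "\<Psi> k (\<iota> f) = k f" if "f < m" for k f
    proof -
      have "\<iota> f \<in> edges H" using that by (intro \<iota>_edge) auto
      then show ?thesis using that by (auto simp: \<Psi>_def \<iota>_def)
    qed
    show "\<forall>k\<in>\<Union>b\<in>B. colourings p b. \<Phi> (\<Psi> k) = k"
    proof
      fix k assume "k \<in> (\<Union>b\<in>B. colourings p b)"
      then have "k \<in> extensional {..<m}" by (auto simp: colourings_def PiE_def m_def)
      then show "\<Phi> (\<Psi> k) = k"
        by (intro extensionalityI[of _ "{..<m}"]) (auto simp: \<Phi>_def \<Psi>\<iota>)
    qed
    show "\<Phi> ` NS \<subseteq> (\<Union>b\<in>B. colourings p b)"
    proof (rule image_subsetI)
      fix C assume C: "C \<in> NS"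
      then have dC: "distinct (map (C \<circ> \<iota>) (inc q v))" if "v \<in> verts H" for v
        using col that by (simp add: NS_def)
      have C3: "C (\<iota> f) < 3" if "f < m" for f
        using C \<iota>_edge[of f] that by (auto simp: NS_def)
      have val: "C (\<iota> d) = 0" "C (\<iota> (m + 3)) = 1" "C (\<iota> (m + 4)) = 2" using C \<iota>s by (simp_all add: NS_def)
      have "distinct [C (\<iota> c), C (\<iota> b), 1]" "distinct [2, C (\<iota> a), C (\<iota> e)]"
        using dC[OF new_verts(1)] dC[OF new_verts(3)] inc_new val \<iota>s by auto
      then have "C (\<iota> b) = 0 \<and> C (\<iota> c) = 2 \<or> C (\<iota> b) = 2 \<and> C (\<iota> c) = 0"
        "C (\<iota> a) = 0 \<and> C (\<iota> e) = 1 \<or> C (\<iota> a) = 1 \<and> C (\<iota> e) = 0"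
        using third_colours(1)[of "C (\<iota> c)" "C (\<iota> b)"] third_colours(2)[of "C (\<iota> a)" "C (\<iota> e)"] C3 lt
        by blast+
      moreover have "map (\<Phi> C) (str p) = [C (\<iota> a), C (\<iota> b), C (\<iota> c), 0, C (\<iota> e)]"
        using lt val by (simp add: str \<Phi>_def)
      ultimately have "map (\<Phi> C) (str p) \<in> B" by (auto simp: B_def)
      moreover have "distinct (map (\<Phi> C) (inc p v))" if v: "v < N" for v
      proof -
        have "map (\<Phi> C) (inc p v) = map (C \<circ> \<iota>) (inc p v)"
          using inc_lt[OF v] by (intro map_cong) (auto simp: \<Phi>_def)
        then show ?thesis using dC[OF old_verts[OF v]] inc_old[OF v] by metis
      qed
      moreover have "\<Phi> C \<in> {..<m} \<rightarrow>\<^sub>E {..<3}" using C3 by (auto simp: \<Phi>_def)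
      ultimately show "\<Phi> C \<in> (\<Union>b\<in>B. colourings p b)" by (simp add: colourings_def m_def N_def)
    qed
    show "\<Psi> ` (\<Union>b\<in>B. colourings p b) \<subseteq> NS"
    proof (rule image_subsetI)
      fix k assume "k \<in> (\<Union>b\<in>B. colourings p b)"
      then have kB: "[k a, k b, k c, k d, k e] \<in> B" and k3: "k \<in> {..<m} \<rightarrow>\<^sub>E {..<3}"
        and kd: "\<And>v. v < N \<Longrightarrow> distinct (map k (inc p v))"
        by (auto simp: colourings_def m_def N_def str)
      have sp: "\<Psi> k (\<iota> (m + 1)) = k a" "\<Psi> k (\<iota> (m + 2)) = k b" "\<Psi> k (\<iota> (m + 3)) = 1" "\<Psi> k (\<iota> (m + 4)) = 2"
        using F_edges \<iota>s by (simp_all add: \<Psi>_def eH)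
      have "distinct (map (\<Psi> k \<circ> \<iota>) (inc q v))" if v: "v \<in> verts H" for v
        using vH_cases[OF v]
      proof (elim disjE)
        assume v: "v < N"
        have "map (\<Psi> k \<circ> \<iota>) (inc p v) = map k (inc p v)"
          using inc_lt[OF v] by (intro map_cong) (auto simp: \<Psi>\<iota>)
        then show ?thesis using kd[OF v] inc_old[OF v] by metis
      next
        assume "v = N + 2"
        then show ?thesis using kB lt by (simp only: inc_new list.map comp_apply sp \<Psi>\<iota>) (auto simp: B_def)
      next
        assume "v = N + 3"
        then show ?thesis using kB lt by (simp only: inc_new list.map comp_apply sp \<Psi>\<iota>) (auto simp: B_def)
      next
        assume "v = N + 4"
        then show ?thesis using kB lt by (simp only: inc_new list.map comp_apply sp \<Psi>\<iota>) (auto simp: B_def)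
      qed
      moreover have P: "\<Psi> k \<in> edges H \<rightarrow>\<^sub>E {..<3}"
      proof
        fix E assume E: "E \<in> edges H"
        then consider f where "f \<in> F" "E = Inl f" | "E = Inr N" | "E = Inr (N + 1)" by (auto simp: eH)
        then show "\<Psi> k E \<in> {..<3}"
        proof cases
          case 1
          then have "f = m + 3 \<or> f = m + 4 \<or> f < m" by (auto simp: F_def)
          then show ?thesis using 1 E k3 by (auto simp: \<Psi>_def)
        qed (use E k3 lt in \<open>auto simp: \<Psi>_def\<close>)
      qed (simp add: \<Psi>_def)
      moreover have "\<Psi> k (Inl d) = 0" using \<Psi>\<iota>[OF lt(4), of k] \<iota>s kB by (auto simp: B_def)
      ultimately show "\<Psi> k \<in> NS" using sp \<iota>s col[of "\<Psi> k"] by (auto simp: NS_def)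
    qed
  qed
  then have "card NS = card (\<Union>b\<in>B. colourings p b)" by (rule bij_betw_same_card)
  also have "\<dots> = (\<Sum>b\<in>B. card (colourings p b))"
  proof (rule card_UN_disjoint)
    show "finite B" by (simp add: B_def)
    show "\<forall>b\<in>B. \<forall>b'\<in>B. b \<noteq> b' \<longrightarrow> colourings p b \<inter> colourings p b' = {}"
      by (auto simp: colourings_def)
  qed simp
  also have "\<dots> = (\<Sum>b\<in>B. n * clookup pentagon_counts b)"
  proof (rule sum.cong[OF refl])
    fix b assume "b \<in> B"
    then have "length b = length (str p)" "set b \<subseteq> {..<3}" by (auto simp: B_def str)
    then show "card (colourings p b) = n * clookup pentagon_counts b"
      using pole unfolding good_def counts_def by blast
  qed
  also have "\<dots> = n * 3"
    unfolding sum_distrib_left[symmetric] pentagon_counts_sum[symmetric] by (simp add: B_def del: clookup.simps)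
  finally have cNS: "card NS = 3 * n" by simp
  define x :: "nat \<Rightarrow> nat + nat" where "x i = (if i = 0 then Inl d else if i = 1 then Inl (m + 3) else Inl (m + 4))" for i
  have "N + 3 \<in> ends H (x i)" for i using at_new(4) by (auto simp: x_def endL)
  then have adj: "adjacent_edges H (x i) (x j)" if "x i \<noteq> x j" for i j
    using that unfolding adjacent_edges_def by blast
  have "card {P. three_edge_decomposition H P} = card {c \<in> edges H \<rightarrow>\<^sub>E {..<3 :: nat}.
      three_edge_colouring H c \<and> c (x 0) = 0 \<and> c (x 1) = 1 \<and> c (x (2 :: nat)) = 2}"
  proof (rule card_decompositions)
    show "x 0 \<in> edges H" "x 1 \<in> edges H" "x 2 \<in> edges H" using F_edges by (simp_all add: x_def)
    show "adjacent_edges H (x 0) (x 1)" "adjacent_edges H (x 0) (x 2)" "adjacent_edges H (x 1) (x 2)"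
      using lt by (auto intro!: adj) (simp_all add: x_def)
  qed
  also have "\<dots> = card NS" by (simp add: NS_def x_def)
  finally show "psi (graph q) (ne p) = n" using cNS by (simp add: psi_def H_def m_def)
qed

theorem corollary5p6:
  fixes i j k l n :: nat
  assumes "n = 2 ^ i * 3 ^ j * 5 ^ k * 7 ^ l"
  shows "\<exists>(G :: (nat, nat) multigraph) e. snark G \<and> e \<in> edges G \<and> psi G e = n"
proof -
  obtain p where "good p n pentagon_counts (cut_table 5 0) pentagon_distances"
    using smooth_pole[of i j k l] unfolding assms by blast
  from psi_closed[OF this] show ?thesis by blast
qed

end
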